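(* For every fixed integer $s\ge 4$, there exists a constant $C_s>0$ such that, for all sufficiently large $n$, \[ f_{s,s+1}^{(4)}(n)\le \exp\left(C_s\frac{\log\log n}{\log\log\log n}\right). \] In particular, for every fixed integer $s\ge 4$, $f_{s,s+1}^{(4)}(n)=(\log n)^{o(1)}$ as $n\to\infty$.
   Context: A $k$-graph is a $k$-uniform hypergraph, and $K_t^{(k)}$ denotes the complete $k$-graph on $t$ vertices. A $k$-graph is $K_t^{(k)}$-free if it contains no copy of $K_t^{(k)}$. For integers $k\le s<t$, the Erdős–Rogers function $f_{s,t}^{(k)}(n)$ is the largest integer $m$ such that every $n$-vertex $K_t^{(k)}$-free $k$-graph contains a set of $m$ vertices spanning no copy of $K_s^{(k)}$ (i.e. the induced subhypergraph on this set is $K_s^{(k)}$-free). Equivalently, $f_{s,t}^{(k)}(n)=\min\{\alpha_s(H): |V(H)|=n,\ H \text{ is a } K_t^{(k)}\text{-free } k\text{-graph}\}$, where $\alpha_s(H)$ is the largest size of a set $W\subseteq V(H)$ such that the induced subhypergraph $H[W]$ contains no copy of $K_s^{(k)}$. *)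

theory Defs
  imports Complex_Main "HOL-Library.Ramsey" "HOL-Library.Landau_Symbols"
begin

text \<open>A \<open>k\<close>-graph is given by its vertex set \<open>V\<close> and its edge set \<open>E\<close>;
  \<open>nsets V k\<close> is the set of all finite \<open>k\<close>-element subsets of \<open>V\<close>.\<close>

definition kgraph :: "nat \<Rightarrow> 'a set \<Rightarrow> 'a set set \<Rightarrow> bool" where
  "kgraph k V E \<longleftrightarrow> finite V \<and> E \<subseteq> nsets V k"

definition induced_edges :: "'a set set \<Rightarrow> 'a set \<Rightarrow> 'a set set" where
  "induced_edges E W = {e \<in> E. e \<subseteq> W}"

text \<open>A copy of the complete \<open>k\<close>-graph on \<open>t\<close> vertices is a \<open>t\<close>-element vertex set
  (necessarily finite) all of whose \<open>k\<close>-element subsets are edges.\<close>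

definition clique_free :: "nat \<Rightarrow> nat \<Rightarrow> 'a set \<Rightarrow> 'a set set \<Rightarrow> bool" where
  "clique_free k t V E \<longleftrightarrow> \<not> (\<exists>T \<in> nsets V t. nsets T k \<subseteq> E)"

text \<open>Vertices are taken to be natural numbers; up to isomorphism this covers all finite
  \<open>k\<close>-graphs. For \<open>1 \<le> k \<le> s < t\<close> the greatest element exists: \<open>m = 0\<close> qualifies, and the
  edgeless \<open>k\<close>-graph on \<open>n\<close> vertices shows that every admissible \<open>m\<close> is at most \<open>n\<close>.\<close>

definition erdos_rogers :: "nat \<Rightarrow> nat \<Rightarrow> nat \<Rightarrow> nat \<Rightarrow> nat" where
  "erdos_rogers k s t n =
    (GREATEST m. \<forall>(V :: nat set) E.
       kgraph k V E \<and> card V = n \<and> clique_free k t V E \<longrightarrow>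
       (\<exists>W \<subseteq> V. card W = m \<and> clique_free k s W (induced_edges E W)))"

end

theory Submission
  imports Defs "HOL-Real_Asymp.Real_Asymp"
begin

text \<open>
The vertices of the \<open>4\<close>-graph are the leaves \<open>0, \<dots>, 2^N - 1\<close> of a binary tree of depth \<open>N\<close>.
Four leaves form an edge if the subtree that they span is a caterpillar (here: a comb) and the
levels of its three branchings form an edge of a given \<open>3\<close>-graph \<open>H\<close> on the levels.
A set of leaves all of whose quadruples are combs is itself a comb, and a comb with \<open>t + 1\<close> leaves
branches on \<open>t\<close> levels. So a \<open>(s + 1)\<close>-clique of leaves yields an \<open>s\<close>-clique of \<open>H\<close>. On the other
hand, descending into the larger half at every branching finds a comb with \<open>M + 1\<close> leaves in any
\<open>2^M\<close> leaves. So if \<open>H\<close> has no \<open>s\<close>-clique while any \<open>M\<close> levels contain an \<open>(s - 1)\<close>-clique, the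
function is below \<open>2^M\<close> for all \<open>n \<le> 2^N\<close> (lemmas \<open>comb_lift_clique_free\<close> and
\<open>comb_lift_clique\<close>). It remains to find \<open>H\<close> with \<open>M = O(ln N / ln (ln N))\<close>, that is, with
\<open>N = M^(c M)\<close>.

Put \<open>q = s - 2\<close> and colour the pairs of levels at random with words of length \<open>d\<close> over \<open>q\<close> letters.
Levels \<open>a < b < c\<close> form an edge if the colours of \<open>(a, b)\<close> and \<open>(a, c)\<close> are far, meaning that they
agree in very few places. Among \<open>q + 1\<close> words some two agree in the first place, some two in the
second, and so on, so no \<open>q + 1\<close> words are pairwise far; looking at the pairs that contain the least
vertex of a clique shows that \<open>H\<close> has no \<open>(q + 2)\<close>-clique. But any \<open>q\<close> sets, each containing at least a
\<open>q^(-D)\<close> proportion of the words, where \<open>d = h D\<close>, have a transversal of pairwise far words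
(\<open>far_transversal\<close>).

The number \<open>r = q^d\<close> of colours is a small power of \<open>M\<close>. By induction on \<open>k\<close>, with high
probability all boxes \<open>W\<^sub>1 < \<dots> < W\<^sub>k\<close> with parts of size about \<open>M\<close> contain at least an \<open>r^(-O(1))\<close>
proportion of cliques among their transversals. There are about \<open>N^(k M)\<close> boxes, so one box may fail
only with probability \<open>M^(-c M^2)\<close>, which means that the colours at a single vertex \<open>a\<close> of a
new first part may fail only with probability \<open>M^(-c M)\<close>. This is \<open>card_poor_colourings\<close>. If hardly
any clique \<open>t\<close> of the box gets pairwise far colours from \<open>a\<close>, then for every list \<open>l\<close> of
pairwise far words the colour classes of \<open>l\<close> span few cliques. Such a nearly independent box is
almost contained in one of very few sparse boxes (\<open>containers\<close>). Fixing these containers, every vertex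
may only take colours whose containers include it. The \<open>r^k\<close> sparse containers cannot cover a
product of halves of the parts, since it is rich in cliques; hence, by the transversal property, at least
half of some part is restricted to a \<open>q^(-D)\<close> proportion of the colours. This costs a factor
\<open>q^(-c D M) = M^(-c' M)\<close>, whereas the choice of the containers costs only \<open>2^M\<close>.
\<close>

section \<open>Combs in the binary tree\<close>

text \<open>
For distinct \<open>u\<close> and \<open>v\<close> this is one more than the highest position in which their binary expansions differ.
\<close>

definition branch_level :: "nat \<Rightarrow> nat \<Rightarrow> nat" where
  "branch_level u v = (LEAST i. u div 2 ^ i = v div 2 ^ i)"

lemma branch_level_le_iff: "branch_level u v \<le> i \<longleftrightarrow> u div 2 ^ i = v div 2 ^ i"
proof
  have "u div 2 ^ (u + v) = v div 2 ^ (u + v)"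
    by (metis add.commute div_less less_exp order.strict_trans1 le_add1)
  then have L: "u div 2 ^ branch_level u v = v div 2 ^ branch_level u v"
    unfolding branch_level_def by (rule LeastI)
  assume "branch_level u v \<le> i"
  then obtain j where j: "i = branch_level u v + j"
    using le_Suc_ex by blast
  show "u div 2 ^ i = v div 2 ^ i"
    unfolding j power_add div_mult2_eq L ..
next
  assume "u div 2 ^ i = v div 2 ^ i"
  then show "branch_level u v \<le> i"
    unfolding branch_level_def by (rule Least_le)
qed

lemma branch_level_commute: "branch_level u v = branch_level v u"
  unfolding branch_level_def by (simp add: eq_commute)

lemma branch_level_ultrametric:
  "branch_level u w \<le> max (branch_level u v) (branch_level v w)"
proof -
  let ?i = "max (branch_level u v) (branch_level v w)"
  have "u div 2 ^ ?i = v div 2 ^ ?i" "v div 2 ^ ?i = w div 2 ^ ?i"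
    using branch_level_le_iff by (metis max.cobounded1, metis max.cobounded2)
  then show ?thesis
    by (simp add: branch_level_le_iff)
qed

lemma branch_level_pos: "u \<noteq> v \<Longrightarrow> 0 < branch_level u v"
  using branch_level_le_iff[of u v 0] by (cases "branch_level u v") auto

lemma branch_level_le:
  assumes "u < 2 ^ N" "v < 2 ^ N"
  shows "branch_level u v \<le> N"
  using assms by (simp add: branch_level_le_iff)

text \<open>
The tree is binary: just below their common branching, three leaves would need three different
children.
\<close>

lemma branch_level_not_equilateral:
  assumes "u \<noteq> v" and "branch_level u v = branch_level v w" and "branch_level u v = branch_level u w"
  shows False
proof -
  obtain i where i: "branch_level u v = Suc i"
    using branch_level_pos[OF assms(1)] gr0_conv_Suc by blast
  let ?d = "\<lambda>x. x div 2 ^ i"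
  have "?d u \<noteq> ?d v" "?d v \<noteq> ?d w" "?d u \<noteq> ?d w"
    using i assms branch_level_le_iff[of _ _ i] by (metis not_less_eq_eq order_refl)+
  moreover have "?d u div 2 = ?d v div 2" "?d v div 2 = ?d w div 2"
    using i assms(2) branch_level_le_iff[of _ _ "Suc i"]
    by (metis div_mult2_eq order_refl power_Suc2)+
  ultimately show False
    using div_mult_mod_eq[of "?d u" 2] div_mult_mod_eq[of "?d v" 2] div_mult_mod_eq[of "?d w" 2]
      mod_less_divisor[of 2 "?d u"] mod_less_divisor[of 2 "?d v"] mod_less_divisor[of 2 "?d w"]
    by linarith
qed

text \<open>
In an ultrametric space the two longest sides of a triangle are equal.
\<close>

lemma branch_level_isosceles:
  assumes "branch_level u p < branch_level v p"
  shows "branch_level u v = branch_level v p"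
  using branch_level_ultrametric[of u v p] branch_level_ultrametric[of v p u] assms
  by (auto simp: branch_level_commute max_def split: if_splits)

text \<open>
The topmost branching of the subtree spanned by \<open>T\<close>, expressed without reference to the tree.
\<close>

lemma top_split:
  assumes "finite T" "2 \<le> card T"
  obtains L R t where "T = L \<union> R" "L \<inter> R = {}" "L \<noteq> {}" "R \<noteq> {}"
    "\<forall>x \<in> L. \<forall>y \<in> R. branch_level x y = t"
    "\<forall>x \<in> L. \<forall>y \<in> L. x \<noteq> y \<longrightarrow> branch_level x y < t"
    "\<forall>x \<in> R. \<forall>y \<in> R. x \<noteq> y \<longrightarrow> branch_level x y < t"
proof -
  let ?D = "(\<lambda>(u, v). branch_level u v) ` (T \<times> T)"
  have "T \<noteq> {}" using assms by auto
  then have fin: "finite ?D" "?D \<noteq> {}" using assms by auto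
  obtain a b where ab: "a \<in> T" "b \<in> T" "a \<noteq> b"
    using assms(2) by (metis card_le_Suc0_iff_eq assms(1) not_less_eq_eq numeral_2_eq_2)
  define t where "t = Max ?D"
  have t: "branch_level x y \<le> t" if "x \<in> T" "y \<in> T" for x y
    using that fin unfolding t_def by (intro Max_ge) auto
  have tpos: "0 < t"
    using t[OF ab(1,2)] branch_level_pos[OF ab(3)] by simp
  obtain u v where uv: "u \<in> T" "v \<in> T" "branch_level u v = t"
    using Max_in[OF fin] unfolding t_def by fastforce
  define L where "L = {x \<in> T. branch_level u x < t}"
  define R where "R = {x \<in> T. branch_level u x = t}"
  have uu: "branch_level u u < t"
    using branch_level_le_iff[of u u 0] tpos by simp
  show thesis
  proof (rule that[of L R t])
    show "T = L \<union> R" using t[OF uv(1)] unfolding L_def R_def by force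
    show "L \<inter> R = {}" unfolding L_def R_def by auto
    show "L \<noteq> {}" using uv uu unfolding L_def by auto
    show "R \<noteq> {}" using uv unfolding R_def by auto
    show "\<forall>x \<in> L. \<forall>y \<in> R. branch_level x y = t"
    proof (intro ballI)
      fix x y assume "x \<in> L" "y \<in> R"
      then show "branch_level x y = t"
        using branch_level_isosceles[of x u y] branch_level_commute[of x u]
          branch_level_commute[of y u] unfolding L_def R_def by simp
    qed
    show "\<forall>x \<in> L. \<forall>y \<in> L. x \<noteq> y \<longrightarrow> branch_level x y < t"
    proof (intro ballI impI)
      fix x y assume "x \<in> L" "y \<in> L"
      then show "branch_level x y < t"
        using branch_level_ultrametric[of x y u] unfolding L_def by (auto simp: branch_level_commute)
    qed
    show "\<forall>x \<in> R. \<forall>y \<in> R. x \<noteq> y \<longrightarrow> branch_level x y < t"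
    proof (intro ballI impI)
      fix x y assume xy: "x \<in> R" "y \<in> R" "x \<noteq> y"
      then have "branch_level x y \<le> t" using t unfolding R_def by auto
      moreover have "branch_level x y \<noteq> t"
        using xy branch_level_not_equilateral[of x y u] unfolding R_def
        by (auto simp: branch_level_commute)
      ultimately show "branch_level x y < t" by simp
    qed
  qed
qed

text \<open>
A set of leaves spans a caterpillar if and only if, seen from one of its two deepest leaves \<open>p\<close>,
the other leaves branch off at different levels.
\<close>

definition comb :: "nat \<Rightarrow> nat set \<Rightarrow> bool" where
  "comb p X \<longleftrightarrow> p \<in> X \<and> inj_on (branch_level p) (X - {p})"

definition levels :: "nat set \<Rightarrow> nat set" where
  "levels X = {branch_level u v | u v. u \<in> X \<and> v \<in> X \<and> u \<noteq> v}"

text \<open>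
The levels seen from \<open>p\<close> are all the levels of the comb, so they do not depend on the choice of \<open>p\<close>.
\<close>

lemma levels_comb:
  assumes "comb p X"
  shows "levels X = branch_level p ` (X - {p})"
proof
  show "branch_level p ` (X - {p}) \<subseteq> levels X"
    using assms unfolding comb_def levels_def by blast
  show "levels X \<subseteq> branch_level p ` (X - {p})"
  proof
    fix t assume "t \<in> levels X"
    then obtain u v where uv: "u \<in> X" "v \<in> X" "u \<noteq> v" "t = branch_level u v"
      unfolding levels_def by auto
    show "t \<in> branch_level p ` (X - {p})"
    proof (cases "u = p \<or> v = p")
      case True
      then show ?thesis
        using uv branch_level_commute[of u v] by (metis Diff_iff empty_iff image_eqI insertE)
    next
      case False
      then have "branch_level u p \<noteq> branch_level v p"
        using assms uv unfolding comb_def inj_on_def by (auto simp: branch_level_commute)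
      then have "t = branch_level p u \<or> t = branch_level p v"
        using branch_level_isosceles[of u p v] branch_level_isosceles[of v p u] uv
          branch_level_commute by (metis linorder_neq_iff)
      then show ?thesis
        using False uv by blast
    qed
  qed
qed

lemma comb_mono: "comb p X \<Longrightarrow> Y \<subseteq> X \<Longrightarrow> p \<in> Y \<Longrightarrow> comb p Y"
  unfolding comb_def by (meson Diff_mono inj_on_subset order_refl)

text \<open>
If \<open>p\<close> is lost, the leaf that branched off closest to \<open>p\<close> takes its place: all other leaves see
both at the same level.
\<close>

lemma comb_subset:
  assumes "comb p X" "Y \<subseteq> X" "finite Y" "Y \<noteq> {}"
  shows "\<exists>p'. comb p' Y"
proof (cases "p \<in> Y")
  case True
  then show ?thesis using assms comb_mono by blast
next
  case False
  define p' where "p' = arg_min_on (branch_level p) Y"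
  have p': "p' \<in> Y" "\<And>x. x \<in> Y \<Longrightarrow> branch_level p p' \<le> branch_level p x"
    unfolding p'_def using assms(3,4) arg_min_if_finite(1) arg_min_least by metis+
  have inj: "inj_on (branch_level p) Y"
    using assms(1,2) False unfolding comb_def by (auto intro: inj_on_subset)
  have eq: "branch_level p' x = branch_level p x" if "x \<in> Y - {p'}" for x
  proof -
    have "branch_level p p' < branch_level p x"
      using that p'(1) p'(2)[of x] inj unfolding inj_on_def by (metis DiffE insertI1 order_le_imp_less_or_eq)
    then show ?thesis
      using branch_level_isosceles[of p' p x] branch_level_commute by metis
  qed
  have "inj_on (branch_level p') (Y - {p'})"
    using inj eq by (simp add: inj_on_def)
  then show ?thesis
    using p' unfolding comb_def by blast
qed

lemma comb_insert:
  assumes "comb p X" "r \<notin> X" "\<And>x. x \<in> X \<Longrightarrow> x \<noteq> p \<Longrightarrow> branch_level p x < branch_level p r"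
  shows "comb p (insert r X)"
proof -
  have "insert r X - {p} = insert r (X - {p})"
    using assms unfolding comb_def by auto
  then show ?thesis
    using assms unfolding comb_def by (fastforce simp: inj_on_insert)
qed

text \<open>
Split at the top, find a comb in the larger half and add one leaf of the other half, which branches
off above everything else.
\<close>

lemma large_comb:
  assumes "finite W" "2 ^ a \<le> card W"
  shows "\<exists>X p. X \<subseteq> W \<and> card X = Suc a \<and> comb p X"
  using assms
proof (induction a arbitrary: W)
  case 0
  then obtain w where "w \<in> W" by fastforce
  then show ?case
    by (intro exI[of _ "{w}"] exI[of _ w]) (auto simp: comb_def)
next
  case (Suc a)
  have "2 \<le> card W"
    by (rule order.trans[OF _ Suc.prems(2)]) simp
  obtain L R t where split: "W = L \<union> R" "L \<inter> R = {}" "L \<noteq> {}" "R \<noteq> {}"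
    "\<forall>x \<in> L. \<forall>y \<in> R. branch_level x y = t"
    "\<forall>x \<in> L. \<forall>y \<in> L. x \<noteq> y \<longrightarrow> branch_level x y < t"
    "\<forall>x \<in> R. \<forall>y \<in> R. x \<noteq> y \<longrightarrow> branch_level x y < t"
    by (rule top_split[OF Suc.prems(1) \<open>2 \<le> card W\<close>]) (rule that; assumption)
  have swapped: "\<forall>x \<in> R. \<forall>y \<in> L. branch_level x y = t"
    using split(5) branch_level_commute by metis
  have fin: "finite L" "finite R" using split(1) Suc.prems(1) by auto
  have step: ?case
    if AB: "A \<union> B = W" "A \<inter> B = {}" "B \<noteq> {}" "finite A" "2 ^ a \<le> card A"
      "\<And>x y. x \<in> A \<Longrightarrow> y \<in> B \<Longrightarrow> branch_level x y = t"
      "\<And>x y. x \<in> A \<Longrightarrow> y \<in> A \<Longrightarrow> x \<noteq> y \<Longrightarrow> branch_level x y < t" for A B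
  proof -
    obtain X p where X: "X \<subseteq> A" "card X = Suc a" "comb p X"
      using Suc.IH[OF AB(4,5)] by blast
    obtain r where r: "r \<in> B" using AB(3) by blast
    have "r \<notin> X" "p \<in> A" using X r AB(2) unfolding comb_def by auto
    have "finite X" using X(2) by (metis card.infinite nat.distinct(1))
    have "comb p (insert r X)"
      using X AB(6)[OF \<open>p \<in> A\<close> r] AB(7)[OF \<open>p \<in> A\<close>]
      by (intro comb_insert \<open>r \<notin> X\<close>) auto
    then show ?case
      using X r AB(1) \<open>r \<notin> X\<close> \<open>finite X\<close>
      by (intro exI[of _ "insert r X"] exI[of _ p]) auto
  qed
  have "card L + card R = card W"
    using split(1,2) fin by (simp add: card_Un_disjoint)
  then have "2 ^ a \<le> card L \<or> 2 ^ a \<le> card R"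
    using Suc.prems(2) by auto
  then show ?case
  proof
    assume "2 ^ a \<le> card L"
    then show ?case
      using split fin by (intro step[of L R]) auto
  next
    assume "2 ^ a \<le> card R"
    then show ?case
      using split swapped fin by (intro step[of R L]) auto
  qed
qed

text \<open>
Two leaves on each side of the topmost branching would form a balanced quadruple, which is not a comb.
So one side is a single leaf, which extends a comb of the other side.
\<close>

lemma comb_if_quadruples_comb:
  assumes "finite T" "T \<noteq> {}" "\<And>e. e \<in> nsets T 4 \<Longrightarrow> \<exists>p. comb p e"
  shows "\<exists>p. comb p T"
  using assms
proof (induction T rule: finite_psubset_induct)
  case (psubset T)
  show ?case
  proof (cases "2 \<le> card T")
    case False
    then obtain w where "T = {w}"
      using psubset.prems(1) psubset.hyps(1)
      by (metis One_nat_def card_0_eq card_1_singletonE less_2_cases not_le)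
    then show ?thesis by (intro exI[of _ w]) (auto simp: comb_def)
  next
    case True
    obtain L R t where split: "T = L \<union> R" "L \<inter> R = {}" "L \<noteq> {}" "R \<noteq> {}"
      "\<forall>x \<in> L. \<forall>y \<in> R. branch_level x y = t"
      "\<forall>x \<in> L. \<forall>y \<in> L. x \<noteq> y \<longrightarrow> branch_level x y < t"
      "\<forall>x \<in> R. \<forall>y \<in> R. x \<noteq> y \<longrightarrow> branch_level x y < t"
      by (rule top_split[OF psubset.hyps(1) True]) (rule that; assumption)
    have swapped: "\<forall>x \<in> R. \<forall>y \<in> L. branch_level x y = t"
      using split(5) branch_level_commute by metis
    have step: ?thesis
      if AB: "A \<union> {r} = T" "r \<notin> A" "A \<noteq> {}"
        "\<And>x. x \<in> A \<Longrightarrow> branch_level x r = t"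
        "\<And>x y. x \<in> A \<Longrightarrow> y \<in> A \<Longrightarrow> x \<noteq> y \<Longrightarrow> branch_level x y < t" for A r
    proof -
      have "A \<subset> T" using AB(1,2) by auto
      moreover have "\<exists>p. comb p e" if "e \<in> nsets A 4" for e
        using psubset.prems(2) that \<open>A \<subset> T\<close> unfolding nsets_def by auto
      ultimately obtain p where p: "comb p A"
        using psubset.IH[OF _ AB(3)] by blast
      then have "p \<in> A" unfolding comb_def by simp
      then have "comb p (insert r A)"
        using p AB by (intro comb_insert) auto
      then show ?thesis using AB(1) by auto
    qed
    have "\<not> (2 \<le> card L \<and> 2 \<le> card R)"
    proof
      assume "2 \<le> card L \<and> 2 \<le> card R"
      then obtain l l' r r' where m: "l \<in> L" "l' \<in> L" "l \<noteq> l'" "r \<in> R" "r' \<in> R" "r \<noteq> r'"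
        by (metis card_le_Suc0_iff_eq card.infinite not_less_eq_eq numeral_2_eq_2 zero_le)
      have d: "l \<noteq> r" "l \<noteq> r'" "l' \<noteq> r" "l' \<noteq> r'" using m split(2) by auto
      have "{l, l', r, r'} \<in> nsets T 4"
        using m d split(1) unfolding nsets_def by auto
      then obtain p where p: "comb p {l, l', r, r'}" using psubset.prems(2) by blast
      have pin: "p \<in> {l, l', r, r'}" using p unfolding comb_def by simp
      have inj: "x = y" if "x \<in> {l, l', r, r'} - {p}" "y \<in> {l, l', r, r'} - {p}"
        "branch_level p x = branch_level p y" for x y
        using p that unfolding comb_def inj_on_def by blast
      have lr: "branch_level x y = t" "branch_level y x = t" if "x \<in> {l, l'}" "y \<in> {r, r'}" for x y
        using that m split(5) branch_level_commute[of y x] by auto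
      show False
      proof (cases "p \<in> {l, l'}")
        case True
        then show False using inj[of r r'] lr(1)[of p r] lr(1)[of p r'] d m by auto
      next
        case False
        then show False using pin inj[of l l'] lr(2)[of l p] lr(2)[of l' p] d m by auto
      qed
    qed
    moreover have "finite L" "finite R" using split(1) psubset.hyps(1) by auto
    ultimately have "card L = 1 \<or> card R = 1"
      using split(3,4) by (metis One_nat_def Suc_1 card_0_eq le_SucE nle_le not_less_eq_eq zero_le
          less_one linorder_not_le order_antisym)
    then show ?thesis
    proof
      assume "card L = 1"
      then obtain r where "L = {r}" using card_1_singletonE by blast
      then show ?thesis
        using split swapped by (intro step[of R r]) auto
    next
      assume "card R = 1"
      then obtain r where "R = {r}" using card_1_singletonE by blast
      then show ?thesis
        using split by (intro step[of L r]) auto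
    qed
  qed
qed

definition comb_lift :: "nat set \<Rightarrow> nat set set \<Rightarrow> nat set set" where
  "comb_lift V H = {e \<in> nsets V 4. (\<exists>p. comb p e) \<and> levels e \<in> H}"

text \<open>
A clique of the lifted graph is a comb, whose levels form a clique of \<open>H\<close> with one vertex less.
\<close>

lemma comb_lift_clique_free:
  assumes H: "clique_free 3 s {..N} H" and V: "V \<subseteq> {..<2 ^ N}"
  shows "clique_free 4 (s + 1) V (comb_lift V H)"
  unfolding clique_free_def
proof
  assume "\<exists>T \<in> nsets V (s + 1). nsets T 4 \<subseteq> comb_lift V H"
  then obtain T where T: "T \<subseteq> V" "finite T" "card T = s + 1" "nsets T 4 \<subseteq> comb_lift V H"
    unfolding nsets_def by auto
  have "\<exists>p. comb p T"
  proof (rule comb_if_quadruples_comb)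
    show "finite T" "T \<noteq> {}" using T(2,3) by auto
    show "\<exists>p. comb p e" if "e \<in> nsets T 4" for e
      using that T(4) unfolding comb_lift_def by blast
  qed
  then obtain p where p: "comb p T" by blast
  then have pT: "p \<in> T" and inj: "inj_on (branch_level p) (T - {p})" unfolding comb_def by auto
  let ?D = "branch_level p ` (T - {p})"
  have "card ?D = s"
    using T(2,3) pT by (simp add: card_image inj)
  moreover have "?D \<subseteq> {..N}"
    using T(1) V pT by (intro image_subsetI) (auto intro!: branch_level_le)
  ultimately have "?D \<in> nsets {..N} s"
    using T(2) unfolding nsets_def by auto
  moreover have "nsets ?D 3 \<subseteq> H"
  proof
    fix f assume "f \<in> nsets ?D 3"
    then have f: "f \<subseteq> ?D" "finite f" "card f = 3" unfolding nsets_def by auto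
    obtain Y where Y: "Y \<subseteq> T - {p}" "f = branch_level p ` Y"
      using f(1) by (meson subset_imageE)
    have "card Y = 3"
      using f(3) Y inj by (metis card_image inj_on_subset)
    have "finite Y" using Y(1) T(2) finite_subset by blast
    have "insert p Y \<in> nsets T 4"
      using Y(1) pT \<open>card Y = 3\<close> \<open>finite Y\<close> unfolding nsets_def
      by (auto simp: card_insert_if)
    then have "levels (insert p Y) \<in> H"
      using T(4) unfolding comb_lift_def by auto
    moreover have "comb p (insert p Y)"
      using p by (rule comb_mono) (use Y(1) pT in auto)
    moreover have "insert p Y - {p} = Y" using Y(1) by auto
    ultimately show "f \<in> H"
      using levels_comb[of p "insert p Y"] Y(2) by simp
  qed
  ultimately show False
    using H unfolding clique_free_def by blast
qed

text \<open>
Conversely, a clique among the levels of a comb lifts to the leaves that branch off there, together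
with the leaf \<open>p\<close>.
\<close>

lemma comb_lift_clique:
  assumes H: "\<And>D. D \<subseteq> {..N} \<Longrightarrow> card D = M \<Longrightarrow> \<exists>S \<in> nsets D s. nsets S 3 \<subseteq> H"
    and W: "W \<subseteq> V" "V \<subseteq> {..<2 ^ N}" and big: "2 ^ M \<le> card W"
  shows "\<not> clique_free 4 (s + 1) W (induced_edges (comb_lift V H) W)"
proof -
  have finW: "finite W" using finite_subset[OF order.trans[OF W]] by simp
  obtain X p where X: "X \<subseteq> W" "card X = Suc M" "comb p X"
    using large_comb[OF finW big] by blast
  have pX: "p \<in> X" and inj: "inj_on (branch_level p) (X - {p})"
    using X(3) unfolding comb_def by auto
  have "finite X" using X(1) finW finite_subset by blast
  let ?D = "branch_level p ` (X - {p})"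
  have "card ?D = M"
    using X(2) pX \<open>finite X\<close> by (simp add: card_image inj)
  moreover have "?D \<subseteq> {..N}"
    using X(1) W pX by (intro image_subsetI) (auto intro!: branch_level_le)
  ultimately obtain S where "S \<in> nsets ?D s" and SH: "nsets S 3 \<subseteq> H"
    using H by blast
  then have S: "S \<subseteq> ?D" "finite S" "card S = s" unfolding nsets_def by auto
  obtain Y where Y: "Y \<subseteq> X - {p}" "S = branch_level p ` Y"
    using S(1) by (meson subset_imageE)
  have "card Y = s"
    using S(3) Y inj by (metis card_image inj_on_subset)
  have "finite Y" using Y(1) \<open>finite X\<close> finite_subset by blast
  let ?T = "insert p Y"
  have combT: "comb p ?T"
    using X(3) by (rule comb_mono) (use Y(1) pX in auto)
  have "?T \<in> nsets W (s + 1)"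
    using Y(1) pX X(1) \<open>card Y = s\<close> \<open>finite Y\<close> unfolding nsets_def
    by (auto simp: card_insert_if)
  moreover have "nsets ?T 4 \<subseteq> induced_edges (comb_lift V H) W"
  proof
    fix e assume "e \<in> nsets ?T 4"
    then have e: "e \<subseteq> ?T" "finite e" "card e = 4" unfolding nsets_def by auto
    have eW: "e \<subseteq> W" using e(1) Y(1) X(1) pX by auto
    have "\<exists>p'. comb p' e"
      using comb_subset[OF combT e(1,2)] e(3) by (metis card.empty zero_neq_numeral)
    then obtain p' where p': "comb p' e" by blast
    have "levels e \<subseteq> levels ?T"
      using e(1) unfolding levels_def by blast
    then have "levels e \<subseteq> S"
      using levels_comb[OF combT] Y by auto
    moreover have "card (levels e) = 3"
      using p' e levels_comb[OF p'] unfolding comb_def by (simp add: card_image)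
    ultimately have "levels e \<in> nsets S 3"
      using S(2) finite_subset unfolding nsets_def by auto
    then show "e \<in> induced_edges (comb_lift V H) W"
      using SH p' eW W e unfolding induced_edges_def comb_lift_def nsets_def by auto
  qed
  ultimately show ?thesis
    unfolding clique_free_def by blast
qed

section \<open>Words agreeing in few places\<close>

definition words :: "nat \<Rightarrow> nat \<Rightarrow> nat list set" where
  "words q d = {x. set x \<subseteq> {..<q} \<and> length x = d}"

lemma finite_words [simp]: "finite (words q d)"
  unfolding words_def by (simp add: finite_lists_length_eq)

lemma card_words [simp]: "card (words q d) = q ^ d"
  unfolding words_def by (simp add: card_lists_length_eq)

lemma words_Suc: "words q (Suc d) = (\<Union>a<q. (#) a ` words q d)"
  unfolding words_def by (auto simp: length_Suc_conv image_iff)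

fun agreement :: "nat list \<Rightarrow> nat list \<Rightarrow> nat" where
  "agreement (a # x) (b # y) = of_bool (a = b) + agreement x y"
| "agreement _ _ = 0"

text \<open>
In every place two of the \<open>q + 1\<close> words carry the same letter.
\<close>

lemma agreement_pigeonhole:
  assumes "\<And>i. i \<le> q \<Longrightarrow> f i \<in> words q d"
  shows "d \<le> (\<Sum>j\<le>q. \<Sum>i<j. agreement (f i) (f j))"
  using assms
proof (induction d arbitrary: f)
  case 0
  then show ?case by simp
next
  case (Suc d)
  define a where "a i = hd (f i)" for i
  define g where "g i = tl (f i)" for i
  have f: "f i = a i # g i" "a i < q" "g i \<in> words q d" if "i \<le> q" for i
  proof -
    have "f i \<in> words q (Suc d)" using Suc.prems that by simp
    then obtain b x where "f i = b # x" "b < q" "x \<in> words q d"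
      unfolding words_Suc by auto
    then show "f i = a i # g i" "a i < q" "g i \<in> words q d" unfolding a_def g_def by auto
  qed
  have "\<not> inj_on a {..q}"
  proof
    assume "inj_on a {..q}"
    then have "card {..q} \<le> card {..<q}"
      using f(2) by (intro card_inj_on_le[of a]) auto
    then show False by simp
  qed
  then obtain i0 j0 where ij: "i0 < j0" "j0 \<le> q" "a i0 = a j0"
    unfolding inj_on_def by (metis atMost_iff linorder_neq_iff)
  have "(1::nat) \<le> (\<Sum>i<j0. of_bool (a i = a j0))"
    using ij by (intro order.trans[OF _ member_le_sum[of i0]]) auto
  also have "\<dots> \<le> (\<Sum>j\<le>q. \<Sum>i<j. of_bool (a i = a j))"
    using ij by (intro member_le_sum[of j0]) auto
  finally have "Suc d \<le> (\<Sum>j\<le>q. \<Sum>i<j. of_bool (a i = a j)) + (\<Sum>j\<le>q. \<Sum>i<j. agreement (g i) (g j))"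
    using Suc.IH[of g] f(3) by simp
  also have "\<dots> = (\<Sum>j\<le>q. \<Sum>i<j. agreement (f i) (f j))"
    unfolding sum.distrib[symmetric] using f(1) by (intro sum.cong refl) auto
  finally show ?case .
qed

text \<open>
The factor exceeds the number of pairs among \<open>q + 1\<close> words, which is what the pigeonhole argument of
the next lemma needs.
\<close>

definition far :: "nat \<Rightarrow> nat list \<Rightarrow> nat list \<Rightarrow> bool" where
  "far q x y \<longleftrightarrow> (q + 1)\<^sup>2 * agreement x y < length x"

lemma no_far_clique:
  assumes "0 < q" "length xs = q + 1" "set xs \<subseteq> words q d"
  shows "\<not> sorted_wrt (far q) xs"
proof
  assume far: "sorted_wrt (far q) xs"
  have w: "xs ! i \<in> words q d" if "i \<le> q" for i
    using that assms by (auto simp: subset_iff)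
  have ag: "(q + 1)\<^sup>2 * agreement (xs ! i) (xs ! j) \<le> d - 1 \<and> 0 < d" if "i < j" "j \<le> q" for i j
  proof -
    have "far q (xs ! i) (xs ! j)"
      using far that assms(2) by (simp add: sorted_wrt_iff_nth_less)
    moreover have "length (xs ! i) = d" using w[of i] that unfolding words_def by simp
    ultimately show ?thesis unfolding far_def by linarith
  qed
  have "(q + 1)\<^sup>2 * d \<le> (q + 1)\<^sup>2 * (\<Sum>j\<le>q. \<Sum>i<j. agreement (xs ! i) (xs ! j))"
    by (intro mult_le_mono2 agreement_pigeonhole w)
  also have "\<dots> = (\<Sum>j\<le>q. \<Sum>i<j. (q + 1)\<^sup>2 * agreement (xs ! i) (xs ! j))"
    by (simp add: sum_distrib_left)
  also have "\<dots> \<le> (\<Sum>j\<le>q. \<Sum>i<j. d - 1)"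
    using ag by (intro sum_mono) auto
  also have "\<dots> \<le> (\<Sum>j\<le>q. (q + 1) * (d - 1))"
  proof (rule sum_mono)
    fix j assume "j \<in> {..q}"
    then have "j * (d - 1) \<le> (q + 1) * (d - 1)" by (intro mult_le_mono1) simp
    then show "(\<Sum>i<j. d - 1) \<le> (q + 1) * (d - 1)" by simp
  qed
  also have "\<dots> = (q + 1)\<^sup>2 * (d - 1)"
    by (simp only: sum_constant card_atMost of_nat_id power2_eq_square Suc_eq_plus1 mult.assoc)
  finally have "d \<le> d - 1" by (simp only: mult_le_cancel1) simp
  moreover have "0 < d" using ag[of 0 q] assms(1) by simp
  ultimately show False by linarith
qed

lemma rotation:
  fixes z :: nat
  assumes "0 < q"
  shows "bij_betw (\<lambda>i. (z + i) mod q) {..<q} {..<q}"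
proof -
  have *: "i = j" if "i \<le> j" "j < q" "(z + i) mod q = (z + j) mod q" for i j
  proof -
    have "q dvd (z + j) - (z + i)"
      using that by (metis add_le_cancel_left mod_eq_dvd_iff_nat)
    then show ?thesis using that by (auto dest: dvd_imp_le)
  qed
  have "inj_on (\<lambda>i. (z + i) mod q) {..<q}"
    using * by (intro inj_onI) (metis lessThan_iff nle_le)
  moreover have "(\<lambda>i. (z + i) mod q) ` {..<q} \<subseteq> {..<q}" using assms by auto
  ultimately show ?thesis
    by (simp add: bij_betw_def endo_inj_surj)
qed

text \<open>
One step in the construction of a transversal. Here \<open>\<rho> i a\<close> is the factor by which the density of
the \<open>i\<close>-th set changes when its next letter is fixed to be \<open>a\<close>. Either the letters can be chosen
distinct at a negligible loss of density, or the densities gain a constant factor.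
\<close>

lemma letter_choice:
  fixes \<eta> :: real
  assumes q: "2 \<le> q" and \<eta>: "0 < \<eta>" "\<eta> \<le> 1"
  shows "\<exists>C>0. \<forall>\<rho>. (\<forall>i<q. (\<Sum>a<q. \<rho> i a) = real q) \<longrightarrow>
    (\<exists>\<sigma>. (\<forall>i<q. \<sigma> i < q \<and> 0 < \<rho> i (\<sigma> i)) \<and>
      of_bool (\<not> inj_on \<sigma> {..<q}) \<le> \<eta> + C * (\<Sum>i<q. ln (\<rho> i (\<sigma> i))))"
proof -
  \<comment> \<open>Possibly equal letters yield a gain of order \<open>\<kappa>\<close> and distinct letters a loss of order \<open>\<kappa>^2\<close> only, because
    the first order terms cancel on average. So for small \<open>\<kappa>\<close> the gain dominates.\<close>
  define \<kappa> where "\<kappa> = \<eta> / (4 * real q ^ 4)"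
  define C where "C = 2 * real q / \<kappa>"
  have q0: "0 < real q" using q by simp
  have q4: "16 \<le> real q ^ 4" using power_mono[of 2 "real q" 4] q by simp
  have \<kappa>: "0 < \<kappa>" "\<kappa> \<le> 1 / 32"
    using \<eta> q4 q0 unfolding \<kappa>_def by (auto simp: divide_simps)
  have C0: "0 < C" using \<kappa> q0 unfolding C_def by simp
  show ?thesis
  proof (intro exI[of _ C] conjI C0 allI impI)
    fix \<rho> :: "nat \<Rightarrow> nat \<Rightarrow> real"
    assume "\<forall>i<q. (\<Sum>a<q. \<rho> i a) = real q"
    then have avg: "(\<Sum>a<q. \<rho> i a) = real q" if "i < q" for i
      using that by blast
    show "\<exists>\<sigma>. (\<forall>i<q. \<sigma> i < q \<and> 0 < \<rho> i (\<sigma> i)) \<and>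
          of_bool (\<not> inj_on \<sigma> {..<q}) \<le> \<eta> + C * (\<Sum>i<q. ln (\<rho> i (\<sigma> i)))"
    proof (cases "\<forall>i<q. \<forall>a<q. 1 - \<kappa> \<le> \<rho> i a")
      case True
      have dev: "ln (\<rho> i a) \<ge> (\<rho> i a - 1) - 2 * (real q * \<kappa>)\<^sup>2" if "i < q" "a < q" for i a
      proof -
        have lo: "1 - \<kappa> \<le> \<rho> i a" using True that by simp
        have "(\<Sum>b\<in>{..<q} - {a}. 1 - \<kappa>) \<le> (\<Sum>b\<in>{..<q} - {a}. \<rho> i b)"
          using True that by (intro sum_mono) auto
        also have "\<dots> = real q - \<rho> i a"
          using avg[OF that(1)] that(2) by (subst sum_diff1) auto
        finally have "\<rho> i a - 1 \<le> (real q - 1) * \<kappa>"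
          using that(2) by (simp add: algebra_simps of_nat_diff)
        also have "\<dots> \<le> real q * \<kappa>" using \<kappa> by simp
        finally have hi: "\<rho> i a - 1 \<le> real q * \<kappa>" .
        have "\<kappa> \<le> real q * \<kappa>" using q \<kappa>(1) by simp
        then have "\<bar>\<rho> i a - 1\<bar> \<le> real q * \<kappa>"
          using lo hi by linarith
        then have sq: "(\<rho> i a - 1)\<^sup>2 \<le> (real q * \<kappa>)\<^sup>2"
          using abs_le_square_iff[of "\<rho> i a - 1" "real q * \<kappa>"] q0 \<kappa> by simp
        have "1 - 1 / \<rho> i a \<le> ln (\<rho> i a)"
        proof -
          have "ln (1 / \<rho> i a) \<le> 1 / \<rho> i a - 1"
            using lo \<kappa> by (intro ln_le_minus_one) simp
          then show ?thesis using lo \<kappa> by (simp add: ln_div)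
        qed
        moreover have "(\<rho> i a - 1) - 2 * (\<rho> i a - 1)\<^sup>2 \<le> 1 - 1 / \<rho> i a"
        proof -
          define u where "u = \<rho> i a - 1"
          have u: "-1 / 2 \<le> u" "\<rho> i a = 1 + u" using lo \<kappa> unfolding u_def by auto
          have "(u - 2 * u\<^sup>2) * (1 + u) = u - u\<^sup>2 * (1 + 2 * u)"
            by (simp add: algebra_simps power2_eq_square)
          also have "\<dots> \<le> u" using u(1) by simp
          finally have "u - 2 * u\<^sup>2 \<le> u / (1 + u)" using u(1) by (simp add: pos_le_divide_eq)
          also have "u / (1 + u) = 1 - 1 / (1 + u)" using u(1) by (simp add: field_simps)
          finally show ?thesis unfolding u(2) by simp
        qed
        ultimately show ?thesis using sq by linarith
      qed
      \<comment> \<open>Distinct letters are obtained as a cyclic shift; the average over all shifts treats every letter of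
        every set equally.\<close>
      define S where "S z = (\<Sum>i<q. ln (\<rho> i ((z + i) mod q)))" for z
      have shift: "(\<Sum>z<q. g ((z + i) mod q)) = (\<Sum>a<q. g a)" for g :: "nat \<Rightarrow> real" and i
        using sum.reindex_bij_betw[OF rotation[of q i], of g] q by (simp add: add.commute)
      have "(\<Sum>z<q. S z) = (\<Sum>i<q. \<Sum>z<q. ln (\<rho> i ((z + i) mod q)))"
        unfolding S_def by (rule sum.swap)
      also have "\<dots> = (\<Sum>i<q. \<Sum>a<q. ln (\<rho> i a))"
        using shift[of "\<lambda>a. ln (\<rho> i a)" i for i] by simp
      also have "\<dots> \<ge> (\<Sum>i<q. \<Sum>a<q. (\<rho> i a - 1) - 2 * (real q * \<kappa>)\<^sup>2)"
        using dev by (intro sum_mono) auto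
      also have "(\<Sum>i<q. \<Sum>a<q. (\<rho> i a - 1) - 2 * (real q * \<kappa>)\<^sup>2) = (\<Sum>i<q. - (2 * real q * (real q * \<kappa>)\<^sup>2))"
        using avg by (intro sum.cong refl) (simp add: sum_subtractf)
      finally have "- (2 * real q ^ 3 * \<kappa>\<^sup>2) * real q \<le> (\<Sum>z<q. S z)"
        by (simp add: power_mult_distrib power2_eq_square power3_eq_cube algebra_simps)
      then have "\<exists>z<q. - (2 * real q ^ 3 * \<kappa>\<^sup>2) \<le> S z"
        using sum_bounded_above_strict[of "{..<q}" S "- (2 * real q ^ 3 * \<kappa>\<^sup>2)"] q
        by (force simp: not_le algebra_simps)
      then obtain z where z: "z < q" "- (2 * real q ^ 3 * \<kappa>\<^sup>2) \<le> S z" by blast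
      have "inj_on (\<lambda>i. (z + i) mod q) {..<q}"
        using rotation[of q z] q by (simp add: bij_betw_def)
      moreover have "0 \<le> \<eta> + C * S z"
      proof -
        have "C * (2 * real q ^ 3 * \<kappa>\<^sup>2) = 4 * real q ^ 4 * \<kappa>"
          using \<kappa> unfolding C_def by (simp add: power2_eq_square power4_eq_xxxx power3_eq_cube)
        also have "\<dots> = \<eta>" using q0 unfolding \<kappa>_def by simp
        finally have "C * (2 * real q ^ 3 * \<kappa>\<^sup>2) = \<eta>" .
        then show ?thesis
          using mult_left_mono[OF z(2), of C] C0 by simp
      qed
      moreover have "0 < \<rho> i a" if "i < q" "a < q" for i a
      proof -
        have "1 - \<kappa> \<le> \<rho> i a" using True that by blast
        then show ?thesis using \<kappa> by linarith
      qed
      ultimately show ?thesis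
        using q unfolding S_def by (intro exI[of _ "\<lambda>i. (z + i) mod q"]) auto
    next
      case False
      then obtain i0 a0 where ia: "i0 < q" "a0 < q" "\<rho> i0 a0 < 1 - \<kappa>" by force
      \<comment> \<open>Some factor is well below its average \<open>1\<close>, so another one in the same row is well above. Taking the
        largest factor in every row gains in that row and loses in none.\<close>
      have one: "\<exists>a<q. 1 \<le> \<rho> i a" if "i < q" for i
      proof (rule ccontr)
        assume "\<not> (\<exists>a<q. 1 \<le> \<rho> i a)"
        then have "(\<Sum>a<q. \<rho> i a) < (\<Sum>a<q. 1)"
          using q by (intro sum_strict_mono) (auto simp: not_le lessThan_empty_iff)
        then show False using avg[OF that] by simp
      qed
      have big: "\<exists>a<q. 1 + \<kappa> / real q \<le> \<rho> i0 a"
      proof (rule ccontr)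
        assume neg: "\<not> (\<exists>a<q. 1 + \<kappa> / real q \<le> \<rho> i0 a)"
        have "(\<Sum>a\<in>{..<q} - {a0}. \<rho> i0 a) \<le> (\<Sum>a\<in>{..<q} - {a0}. 1 + \<kappa> / real q)"
          using neg by (intro sum_mono) (auto simp: not_le intro: less_imp_le)
        also have "\<dots> = (real q - 1) * (1 + \<kappa> / real q)"
          using ia(2) by (simp add: of_nat_diff)
        also have "\<dots> \<le> real q - 1 + \<kappa>"
          using q0 \<kappa> by (simp add: field_simps)
        finally have "(\<Sum>a\<in>{..<q} - {a0}. \<rho> i0 a) \<le> real q - 1 + \<kappa>" .
        moreover have "(\<Sum>a\<in>{..<q} - {a0}. \<rho> i0 a) = real q - \<rho> i0 a0"
          using avg[OF ia(1)] ia(2) by (subst sum_diff1) auto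
        ultimately show False using ia(3) by simp
      qed
      have "\<forall>i\<in>{..<q}. \<exists>a. a < q \<and> 1 \<le> \<rho> i a \<and> (i = i0 \<longrightarrow> 1 + \<kappa> / real q \<le> \<rho> i a)"
      proof
        fix i assume "i \<in> {..<q}"
        then show "\<exists>a. a < q \<and> 1 \<le> \<rho> i a \<and> (i = i0 \<longrightarrow> 1 + \<kappa> / real q \<le> \<rho> i a)"
        proof (cases "i = i0")
          case True
          obtain a where "a < q" "1 + \<kappa> / real q \<le> \<rho> i0 a" using big by blast
          moreover have "0 \<le> \<kappa> / real q" using \<kappa> q0 by simp
          ultimately show ?thesis using True by (intro exI[of _ a]) auto
        next
          case False
          then show ?thesis using one[of i] \<open>i \<in> {..<q}\<close> by auto
        qed
      qed
      then obtain \<sigma> where \<sigma>: "\<And>i. i < q \<Longrightarrow> \<sigma> i < q" "\<And>i. i < q \<Longrightarrow> 1 \<le> \<rho> i (\<sigma> i)"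
        "1 + \<kappa> / real q \<le> \<rho> i0 (\<sigma> i0)"
        using ia(1) unfolding bchoice_iff by (metis lessThan_iff)
      have "\<kappa> / (2 * real q) \<le> ln (\<rho> i0 (\<sigma> i0))"
      proof -
        have x: "0 \<le> \<kappa> / real q" "\<kappa> / real q \<le> 1 / 2"
          using \<kappa> q q0 by (auto simp: divide_simps)
        have "\<kappa> / (2 * real q) \<le> \<kappa> / real q - (\<kappa> / real q)\<^sup>2"
          using x mult_left_mono[OF x(2) x(1)] by (simp add: power2_eq_square)
        also have "\<dots> \<le> ln (1 + \<kappa> / real q)"
          using x by (intro ln_one_plus_pos_lower_bound; linarith)
        also have "\<dots> \<le> ln (\<rho> i0 (\<sigma> i0))"
          using \<sigma>(3) x(1) by (subst ln_le_cancel_iff) linarith+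
        finally show ?thesis .
      qed
      also have "\<dots> \<le> (\<Sum>i<q. ln (\<rho> i (\<sigma> i)))"
        using \<sigma>(2) ia(1) by (intro member_le_sum) auto
      finally have "C * (\<kappa> / (2 * real q)) \<le> C * (\<Sum>i<q. ln (\<rho> i (\<sigma> i)))"
        by (rule mult_left_mono) (use C0 in simp)
      moreover have "C * (\<kappa> / (2 * real q)) = 1"
        using \<kappa> q0 unfolding C_def by simp
      ultimately have "1 \<le> \<eta> + C * (\<Sum>i<q. ln (\<rho> i (\<sigma> i)))"
        using \<eta> by linarith
      moreover have "0 < \<rho> i (\<sigma> i)" if "i < q" for i
        using \<sigma>(2)[OF that] by simp
      ultimately show ?thesis
        using \<sigma>(1) by (intro exI[of _ \<sigma>]) (auto simp: of_bool_def)
    qed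
  qed
qed

text \<open>
The letters of the \<open>q\<close> words are fixed one place at a time. Steps in which the letters coincide are
paid for by a gain in the densities, which can never exceed \<open>1\<close>; so their number is bounded in terms
of the initial densities.
\<close>

lemma transversal_few_agreements:
  fixes \<eta> :: real
  assumes q: "2 \<le> q" and \<eta>: "0 < \<eta>" "\<eta> \<le> 1"
  shows "\<exists>C>0. \<forall>d Y. (\<forall>i<q. Y i \<subseteq> words q d \<and> Y i \<noteq> {}) \<longrightarrow>
      (\<exists>x. (\<forall>i<q. x i \<in> Y i) \<and> (\<forall>j<q. \<forall>i<j.
        real (agreement (x i) (x j)) \<le> \<eta> * d + C * (\<Sum>i<q. ln (real (q ^ d) / card (Y i)))))"
proof -
  obtain C where C: "C > 0" and choice:
    "\<forall>\<rho>. (\<forall>i<q. (\<Sum>a<q. \<rho> i a) = real q) \<longrightarrow>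
      (\<exists>\<sigma>. (\<forall>i<q. \<sigma> i < q \<and> 0 < \<rho> i (\<sigma> i)) \<and>
          of_bool (\<not> inj_on \<sigma> {..<q}) \<le> \<eta> + C * (\<Sum>i<q. ln (\<rho> i (\<sigma> i))))"
    using letter_choice[OF q \<eta>] by blast
  have "\<exists>x. (\<forall>i<q. x i \<in> Y i) \<and> (\<forall>j<q. \<forall>i<j.
        real (agreement (x i) (x j)) \<le> \<eta> * d + C * (\<Sum>i<q. ln (real (q ^ d) / card (Y i))))"
    if "\<And>i. i < q \<Longrightarrow> Y i \<subseteq> words q d \<and> Y i \<noteq> {}" for d Y
    using that
  proof (induction d arbitrary: Y)
    case 0
    then have Y: "Y i = {[]}" if "i < q" for i
      using that unfolding words_def by fastforce
    then show ?case
      by (intro exI[of _ "\<lambda>_. []"]) simp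
  next
    case (Suc d)
    define Z where "Z i a = {x \<in> words q d. a # x \<in> Y i}" for i a
    have finZ: "finite (Z i a)" for i a unfolding Z_def by simp
    have Yfin: "finite (Y i)" "0 < card (Y i)" if "i < q" for i
      using Suc.prems[OF that] finite_subset[of "Y i" "words q (Suc d)"]
      by (auto simp: card_gt_0_iff)
    have cardY: "card (Y i) = (\<Sum>a<q. card (Z i a))" if iq: "i < q" for i
    proof -
      have "Y i = (\<Union>a<q. (#) a ` Z i a)"
      proof
        show "(\<Union>a<q. (#) a ` Z i a) \<subseteq> Y i" unfolding Z_def by auto
        show "Y i \<subseteq> (\<Union>a<q. (#) a ` Z i a)"
        proof
          fix y assume y: "y \<in> Y i"
          then obtain a x where "a < q" "x \<in> words q d" "y = a # x"
            using Suc.prems[OF iq] unfolding words_Suc by blast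
          then show "y \<in> (\<Union>a<q. (#) a ` Z i a)" using y unfolding Z_def by blast
        qed
      qed
      then have "card (Y i) = (\<Sum>a<q. card ((#) a ` Z i a))"
        using finZ by (simp only:) (intro card_UN_disjoint, auto)
      then show ?thesis by (simp add: card_image)
    qed
    define \<rho> where "\<rho> i a = real q * card (Z i a) / card (Y i)" for i a
    have "\<exists>\<sigma>. (\<forall>i<q. \<sigma> i < q \<and> 0 < \<rho> i (\<sigma> i)) \<and>
          of_bool (\<not> inj_on \<sigma> {..<q}) \<le> \<eta> + C * (\<Sum>i<q. ln (\<rho> i (\<sigma> i)))"
    proof (rule choice[rule_format])
      show "(\<Sum>a<q. \<rho> i a) = real q" if "i < q" for i
      proof -
        have "real (card (Y i)) = (\<Sum>a<q. real (card (Z i a)))" by (simp add: cardY[OF that])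
        then show ?thesis
          using Yfin(2)[OF that] unfolding \<rho>_def
          by (simp add: sum_divide_distrib[symmetric] sum_distrib_left[symmetric])
      qed
    qed
    then obtain \<sigma> where \<sigma>: "\<And>i. i < q \<Longrightarrow> \<sigma> i < q" "\<And>i. i < q \<Longrightarrow> 0 < \<rho> i (\<sigma> i)"
      "of_bool (\<not> inj_on \<sigma> {..<q}) \<le> \<eta> + C * (\<Sum>i<q. ln (\<rho> i (\<sigma> i)))"
      by blast
    have Zpos: "0 < card (Z i (\<sigma> i))" if "i < q" for i
      using \<sigma>(2)[OF that] unfolding \<rho>_def by (cases "card (Z i (\<sigma> i))") auto
    have "\<exists>x. (\<forall>i<q. x i \<in> Z i (\<sigma> i)) \<and> (\<forall>j<q. \<forall>i<j. real (agreement (x i) (x j))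
        \<le> \<eta> * d + C * (\<Sum>i<q. ln (real (q ^ d) / card (Z i (\<sigma> i)))))"
      using Zpos by (intro Suc.IH) (auto simp: Z_def card_gt_0_iff)
    then obtain x where x: "\<And>i. i < q \<Longrightarrow> x i \<in> Z i (\<sigma> i)"
      "\<And>i j. j < q \<Longrightarrow> i < j \<Longrightarrow> real (agreement (x i) (x j))
        \<le> \<eta> * d + C * (\<Sum>i<q. ln (real (q ^ d) / card (Z i (\<sigma> i))))" by blast
    have "ln (real (q ^ d) / card (Z i (\<sigma> i))) = ln (real (q ^ Suc d) / card (Y i)) - ln (\<rho> i (\<sigma> i))"
      if "i < q" for i
    proof -
      have "real (q ^ d) / card (Z i (\<sigma> i)) = real (q ^ Suc d) / card (Y i) / \<rho> i (\<sigma> i)"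
        using q Zpos[OF that] Yfin(2)[OF that] unfolding \<rho>_def by (simp add: field_simps)
      then show ?thesis
        using \<sigma>(2)[OF that] q Yfin(2)[OF that] by (simp only:) (intro ln_divide_pos, auto)
    qed
    then have sums: "(\<Sum>i<q. ln (real (q ^ d) / card (Z i (\<sigma> i))))
      = (\<Sum>i<q. ln (real (q ^ Suc d) / card (Y i))) - (\<Sum>i<q. ln (\<rho> i (\<sigma> i)))"
      by (simp add: sum_subtractf[symmetric])
    show ?case
    proof (intro exI[of _ "\<lambda>i. \<sigma> i # x i"] conjI allI impI)
      fix i assume "i < q"
      then show "\<sigma> i # x i \<in> Y i" using x(1) unfolding Z_def by blast
    next
      fix j i assume ij: "j < q" "i < j"
      have "real (of_bool (\<sigma> i = \<sigma> j)) \<le> of_bool (\<not> inj_on \<sigma> {..<q})"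
        using ij by (auto simp: inj_on_def)
      also note \<sigma>(3)
      finally have "real (agreement (\<sigma> i # x i) (\<sigma> j # x j))
        \<le> \<eta> + C * (\<Sum>i<q. ln (\<rho> i (\<sigma> i)))
          + (\<eta> * d + C * (\<Sum>i<q. ln (real (q ^ d) / card (Z i (\<sigma> i)))))"
        using x(2)[OF ij] by simp
      also have "\<dots> = \<eta> * Suc d + C * (\<Sum>i<q. ln (real (q ^ Suc d) / card (Y i)))"
        unfolding sums by (simp add: algebra_simps)
      finally show "real (agreement (\<sigma> i # x i) (\<sigma> j # x j))
        \<le> \<eta> * Suc d + C * (\<Sum>i<q. ln (real (q ^ Suc d) / card (Y i)))" .
    qed
  qed
  then show ?thesis using C by blast
qed

definition box :: "'a set list \<Rightarrow> 'a list set" where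
  "box Ws = {t. list_all2 (\<in>) t Ws}"

definition far_lists :: "nat \<Rightarrow> nat \<Rightarrow> nat \<Rightarrow> nat list list set" where
  "far_lists q d k = {l. length l = k \<and> set l \<subseteq> words q d \<and> sorted_wrt (far q) l}"

text \<open>
For \<open>h\<close> large, sets that contain a \<open>q^(-D)\<close> proportion of the words of length \<open>h D\<close> are so dense that
the bound of the preceding lemma is below the threshold for being far.
\<close>

lemma far_transversal:
  assumes q: "2 \<le> q"
  shows "\<exists>h>0. \<forall>D>0. \<forall>Ys. length Ys \<le> q \<longrightarrow>
      (\<forall>Y \<in> set Ys. Y \<subseteq> words q (h * D) \<and> q ^ (h * D) \<le> q ^ D * card Y) \<longrightarrow>
      far_lists q (h * D) (length Ys) \<inter> box Ys \<noteq> {}"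
proof -
  define Q where "Q = real ((q + 1)\<^sup>2)"
  have Q: "1 \<le> Q" unfolding Q_def by (simp add: power2_eq_square)
  define \<eta> where "\<eta> = 1 / (3 * Q)"
  have \<eta>: "0 < \<eta>" "\<eta> \<le> 1" using Q unfolding \<eta>_def by auto
  obtain C where C: "C > 0" and tr:
    "\<forall>d Y. (\<forall>i<q. Y i \<subseteq> words q d \<and> Y i \<noteq> {}) \<longrightarrow>
      (\<exists>x. (\<forall>i<q. x i \<in> Y i) \<and> (\<forall>j<q. \<forall>i<j.
        real (agreement (x i) (x j)) \<le> \<eta> * d + C * (\<Sum>i<q. ln (real (q ^ d) / card (Y i)))))"
    using transversal_few_agreements[OF q \<eta>] by (elim exE conjE) (rule that)
  define h where "h = nat \<lceil>3 * Q * C * q * ln q\<rceil> + 1"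
  have h: "3 * Q * C * q * ln q \<le> h" unfolding h_def by linarith
  show ?thesis
  proof (intro exI[of _ h] conjI allI impI)
    show "0 < h" unfolding h_def by simp
    fix D :: nat and Ys :: "nat list set list"
    assume D: "0 < D" and le: "length Ys \<le> q" and
      "\<forall>Y \<in> set Ys. Y \<subseteq> words q (h * D) \<and> q ^ (h * D) \<le> q ^ D * card Y"
    then have Ys: "Y \<in> set Ys \<Longrightarrow> Y \<subseteq> words q (h * D) \<and> q ^ (h * D) \<le> q ^ D * card Y" for Y
      by blast
    define k where "k = length Ys"
    have k: "k \<le> q" "length Ys = k" using le unfolding k_def by auto
    let ?d = "h * D"
    have d: "0 < ?d" using D unfolding h_def by simp
    \<comment> \<open>Shorter lists are padded with the set of all words.\<close>
    define Y where "Y i = (if i < k then Ys ! i else words q ?d)" for i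
    have Y: "Y i \<subseteq> words q ?d \<and> q ^ ?d \<le> q ^ D * card (Y i)" for i
      using Ys k(2) q unfolding Y_def by (auto simp: nth_mem)
    have cY: "0 < card (Y i)" for i
    proof (rule ccontr)
      assume "\<not> 0 < card (Y i)"
      then have "q ^ ?d = 0" using Y[of i] by simp
      then show False using q by simp
    qed
    have "\<exists>x. (\<forall>i<q. x i \<in> Y i) \<and> (\<forall>j<q. \<forall>i<j.
        real (agreement (x i) (x j)) \<le> \<eta> * ?d + C * (\<Sum>i<q. ln (real (q ^ ?d) / card (Y i))))"
      using Y cY by (intro tr[rule_format]) (auto simp: card_gt_0_iff)
    then obtain x where x: "\<And>i. i < q \<Longrightarrow> x i \<in> Y i"
      "\<And>i j. j < q \<Longrightarrow> i < j \<Longrightarrow> real (agreement (x i) (x j))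
        \<le> \<eta> * ?d + C * (\<Sum>i<q. ln (real (q ^ ?d) / card (Y i)))" by blast
    have "ln (real (q ^ ?d) / card (Y i)) \<le> D * ln q" for i
    proof -
      have "real (q ^ ?d) \<le> real (q ^ D * card (Y i))" using Y[of i] by (simp only: of_nat_le_iff)
      then have "real (q ^ ?d) / card (Y i) \<le> real q ^ D"
        using cY[of i] by (simp add: pos_divide_le_eq)
      then have "ln (real (q ^ ?d) / card (Y i)) \<le> ln (real q ^ D)"
        using q cY[of i] by (subst ln_le_cancel_iff) auto
      then show ?thesis using q by (simp add: ln_realpow)
    qed
    then have "(\<Sum>i<q. ln (real (q ^ ?d) / card (Y i))) \<le> (\<Sum>i<q. D * ln q)"
      by (intro sum_mono)
    then have "C * (\<Sum>i<q. ln (real (q ^ ?d) / card (Y i))) \<le> C * (q * (D * ln q))"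
      using C by (intro mult_left_mono) auto
    moreover have "Q * (C * (q * (D * ln q))) \<le> ?d / 3"
      using mult_right_mono[OF h, of D] by (simp add: algebra_simps)
    moreover have "Q * (\<eta> * ?d) = ?d / 3" using Q unfolding \<eta>_def by simp
    ultimately have "Q * (\<eta> * ?d) + Q * (C * (\<Sum>i<q. ln (real (q ^ ?d) / card (Y i)))) \<le> 2 * (?d / 3)"
      using Q mult_left_mono[of "C * (\<Sum>i<q. ln (real (q ^ ?d) / card (Y i)))" "C * (q * (D * ln q))" Q]
      by linarith
    then have "Q * (\<eta> * ?d + C * (\<Sum>i<q. ln (real (q ^ ?d) / card (Y i)))) \<le> 2 * (?d / 3)"
      by (simp only: distrib_left)
    also have "\<dots> < ?d" using d by simp
    finally have lt: "Q * (\<eta> * ?d + C * (\<Sum>i<q. ln (real (q ^ ?d) / card (Y i)))) < ?d" .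
    have far: "far q (x i) (x j)" if "j < q" "i < j" for i j
    proof -
      have "Q * real (agreement (x i) (x j)) < ?d"
        using x(2)[OF that] Q by (intro le_less_trans[OF _ lt] mult_left_mono) auto
      then have "(q + 1)\<^sup>2 * agreement (x i) (x j) < ?d"
        unfolding Q_def by (simp only: of_nat_mult[symmetric] of_nat_less_iff)
      moreover have "length (x i) = ?d"
        using x(1)[of i] Y[of i] that unfolding words_def by auto
      ultimately show ?thesis unfolding far_def by simp
    qed
    have "set (map x [0..<k]) \<subseteq> words q ?d"
    proof
      fix y assume "y \<in> set (map x [0..<k])"
      then obtain i where "i < k" "y = x i" by auto
      then have "i < q" using k(1) by simp
      then show "y \<in> words q ?d" using x(1)[of i] Y[of i] \<open>y = x i\<close> by blast
    qed
    moreover have "sorted_wrt (far q) (map x [0..<k])"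
      using far k(1) by (simp add: sorted_wrt_iff_nth_less)
    ultimately have "map x [0..<k] \<in> far_lists q ?d k"
      unfolding far_lists_def by simp
    moreover have "map x [0..<k] ! i \<in> Ys ! i" if "i < k" for i
      using x(1)[of i] k that unfolding Y_def by simp
    then have "map x [0..<k] \<in> box Ys"
      using k(2) unfolding box_def by (simp add: list_all2_conv_all_nth)
    ultimately show "far_lists q ?d (length Ys) \<inter> box Ys \<noteq> {}" unfolding k(2) by blast
  qed
qed

section \<open>Containers for nearly independent boxes\<close>

lemma box_Nil [simp]: "box [] = {[]}"
  unfolding box_def by auto

lemma box_Cons: "box (W # Ws) = (\<Union>a\<in>W. (#) a ` box Ws)"
  unfolding box_def by (auto simp: list_all2_Cons2)

lemma Cons_mem_box [simp]: "a # t \<in> box (W # Ws) \<longleftrightarrow> a \<in> W \<and> t \<in> box Ws"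
  unfolding box_def by simp

lemma finite_box: "(\<And>W. W \<in> set Ws \<Longrightarrow> finite W) \<Longrightarrow> finite (box Ws)"
  by (induction Ws) (auto simp: box_Cons)

lemma box_mono: "list_all2 (\<subseteq>) As Bs \<Longrightarrow> box As \<subseteq> box Bs"
  by (induction As Bs rule: list_all2_induct) (auto simp: box_Cons)

lemma card_links:
  assumes "finite W" "\<And>X. X \<in> set Ws \<Longrightarrow> finite X"
  shows "card (T \<inter> box (W # Ws)) = (\<Sum>a\<in>W. card {t \<in> box Ws. a # t \<in> T})"
proof -
  have fin: "finite {t \<in> box Ws. a # t \<in> T}" for a
    using finite_box[OF assms(2)] by simp
  have "T \<inter> box (W # Ws) = (\<Union>a\<in>W. (#) a ` {t \<in> box Ws. a # t \<in> T})"
    unfolding box_Cons by auto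
  then have "card (T \<inter> box (W # Ws)) = (\<Sum>a\<in>W. card ((#) a ` {t \<in> box Ws. a # t \<in> T}))"
    using assms(1) fin by (simp only:) (intro card_UN_disjoint, auto)
  then show ?thesis by (simp add: card_image)
qed

lemma card_box_le:
  assumes "\<And>W. W \<in> set Ws \<Longrightarrow> finite W \<and> card W \<le> m"
  shows "card (box Ws) \<le> m ^ length Ws"
  using assms
proof (induction Ws)
  case (Cons W Ws)
  have "card (UNIV \<inter> box (W # Ws)) = (\<Sum>a\<in>W. card {t \<in> box Ws. a # t \<in> UNIV})"
    using Cons.prems by (intro card_links) auto
  then have "card (box (W # Ws)) = card W * card (box Ws)" by simp
  also have "\<dots> \<le> m * m ^ length Ws"
    using Cons by (intro mult_le_mono) auto
  finally show ?case by simp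
qed simp

lemma card_small_subsets:
  assumes "finite W" "card W \<le> m"
  shows "card {D. D \<subseteq> W \<and> card D \<le> L} \<le> (m + 1) ^ L"
proof -
  \<comment> \<open>Small sets are encoded by lists of length exactly \<open>L\<close> that are padded with \<open>None\<close>.\<close>
  let ?f = "\<lambda>xs. {x. Some x \<in> set xs}"
  let ?A = "insert None (Some ` W)"
  have "{D. D \<subseteq> W \<and> card D \<le> L} \<subseteq> ?f ` {xs. set xs \<subseteq> ?A \<and> length xs = L}"
  proof
    fix D assume "D \<in> {D. D \<subseteq> W \<and> card D \<le> L}"
    then have D: "D \<subseteq> W" "card D \<le> L" by auto
    then obtain ys where ys: "set ys = D" "length ys = card D"
      using assms(1) by (metis finite_distinct_list distinct_card finite_subset)
    let ?xs = "map Some ys @ replicate (L - card D) None"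
    have "?f ?xs = D" using ys by auto
    moreover have "length ?xs = L" "set ?xs \<subseteq> ?A" using ys D by auto
    ultimately show "D \<in> ?f ` {xs. set xs \<subseteq> ?A \<and> length xs = L}" by blast
  qed
  then have "card {D. D \<subseteq> W \<and> card D \<le> L} \<le> card {xs. set xs \<subseteq> ?A \<and> length xs = L}"
    using assms(1) by (intro surj_card_le) (auto simp: finite_lists_length_eq)
  also have "\<dots> = card ?A ^ L"
    using assms(1) by (intro card_lists_length_eq) simp
  also have "\<dots> \<le> (m + 1) ^ L"
    using assms by (intro power_mono) (auto simp: card_image)
  finally show ?thesis .
qed

text \<open>
Take a largest \<open>D\<close> whose union has at least \<open>\<theta>\<close> points per member: any set that contributes \<open>\<theta>\<close>
further points could be added.
\<close>

lemma greedy_cover: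
  fixes \<theta> :: real
  assumes fin: "finite G" "finite S" and sub: "\<And>d. d \<in> G \<Longrightarrow> F d \<subseteq> S"
    and \<theta>: "0 < \<theta>"
  shows "\<exists>D \<subseteq> G. card D * \<theta> \<le> card S \<and> (\<forall>d \<in> G. card (F d - (\<Union>c\<in>D. F c)) < \<theta>)"
proof -
  define P where "P D \<longleftrightarrow> D \<subseteq> G \<and> card D * \<theta> \<le> card (\<Union>c\<in>D. F c)" for D
  have "finite {D. P D}" unfolding P_def using fin(1) by simp
  moreover have "P {}" unfolding P_def by simp
  ultimately obtain D where D: "P D" "\<And>D'. P D' \<Longrightarrow> card D' \<le> card D"
    using finite_has_maximal[of "card ` {D. P D}"] by (auto) (metis nle_le)
  have DG: "D \<subseteq> G" "finite D" using D(1) fin(1) finite_subset unfolding P_def by auto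
  have US: "(\<Union>c\<in>D. F c) \<subseteq> S" using sub DG by auto
  then have finU: "finite (\<Union>c\<in>D. F c)" using fin(2) finite_subset by blast
  have "card D * \<theta> \<le> card S"
    using D(1) card_mono[OF fin(2) US] unfolding P_def by linarith
  moreover have "card (F d - (\<Union>c\<in>D. F c)) < \<theta>" if d: "d \<in> G" for d
  proof (rule ccontr)
    assume neg: "\<not> card (F d - (\<Union>c\<in>D. F c)) < \<theta>"
    have "d \<notin> D"
    proof
      assume "d \<in> D"
      then have "F d - (\<Union>c\<in>D. F c) = {}" by auto
      then have "card (F d - (\<Union>c\<in>D. F c)) = 0" by (simp only: card.empty)
      then show False using neg \<theta> by linarith
    qed
    have "(\<Union>c\<in>insert d D. F c) = (\<Union>c\<in>D. F c) \<union> (F d - (\<Union>c\<in>D. F c))" by auto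
    moreover have "finite (F d)" using sub[OF d] fin(2) finite_subset by blast
    ultimately have "card (\<Union>c\<in>insert d D. F c) = card (\<Union>c\<in>D. F c) + card (F d - (\<Union>c\<in>D. F c))"
      using finU by (simp only:) (intro card_Un_disjoint, auto)
    then have "P (insert d D)"
      using D(1) neg d \<open>d \<notin> D\<close> DG(2) unfolding P_def by (simp add: algebra_simps)
    then show False
      using D(2) \<open>d \<notin> D\<close> DG(2) by fastforce
  qed
  ultimately show ?thesis using DG by blast
qed

text \<open>
Hypergraph containers for dense partite hypergraphs, where \<open>T\<close> is the set of hyperedges and
\<open>length Ws\<close> the uniformity. All but few vertices \<open>d\<close> of the first part of a nearly independent box \<open>A\<close>
have a link that is nearly independent on the rest of \<open>A\<close>. Boundedly many of these links cover the
other ones up to a proportion \<open>\<tau>\<close>. The union of the chosen links is a hypergraph of smaller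
uniformity for which the rest of \<open>A\<close> is still nearly independent, so induction applies to it; and the
first part is almost contained in the set of all vertices whose links are almost covered. The whole
container depends only on the boundedly many chosen vertices, which bounds the size of the family.
\<close>

lemma containers:
  fixes \<tau> \<kappa> :: real
  assumes \<tau>: "0 < \<tau>" and \<kappa>: "0 < \<kappa>" and L: "1 \<le> L * \<tau>" and m: "0 < m"
    and Ws: "\<And>W. W \<in> set Ws \<Longrightarrow> finite W \<and> card W \<le> m"
  shows "\<exists>\<F>. finite \<F> \<and> card \<F> \<le> (m + 1) ^ (length Ws * L) \<and>
     (\<forall>B\<in>\<F>. list_all2 (\<subseteq>) B Ws \<and> real (card (T \<inter> box B)) \<le> length Ws * \<tau> * real m ^ length Ws) \<and>
     (\<forall>A. list_all2 (\<subseteq>) A Ws \<longrightarrow> real (card (T \<inter> box A)) < (\<kappa> * \<tau>) ^ length Ws * real m ^ length Ws \<longrightarrow>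
        (\<exists>B\<in>\<F>. list_all2 (\<lambda>a b. card (a - b) \<le> \<kappa> * m) A B))"
  using Ws
proof (induction Ws arbitrary: T)
  case Nil
  show ?case
  proof (cases "[] \<in> T")
    case True
    then have "T \<inter> {[]} = {[]}" by auto
    then show ?thesis by (intro exI[of _ "{}"]) simp
  next
    case False
    then have "T \<inter> {[]} = {}" by auto
    then show ?thesis by (intro exI[of _ "{[]}"]) simp
  qed
next
  case (Cons W Ws)
  let ?k = "length Ws"
  let ?M = "real m ^ ?k"
  have M: "0 < ?M" using m by simp
  have W: "finite W" "card W \<le> m" and finWs: "\<And>X. X \<in> set Ws \<Longrightarrow> finite X"
    using Cons.prems by auto
  have finbox: "finite (box Ws)" using finWs by (rule finite_box)
  have cbox: "real (card (box Ws)) \<le> ?M"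
    using card_box_le[of Ws m] Cons.prems by (simp flip: of_nat_power)
  define link where "link d = {t \<in> box Ws. d # t \<in> T}" for d
  define F where "F D = (\<Union>d\<in>D. link d)" for D
  have linkbox: "link d \<subseteq> box Ws" for d unfolding link_def by auto
  have Fbox: "F D \<subseteq> box Ws" for D using linkbox unfolding F_def by auto
  \<comment> \<open>The container determined by the set \<open>D\<close> of chosen vertices has \<open>low D\<close> as its first part.\<close>
  define low where "low D = {d \<in> W. card (link d - F D) < \<tau> * ?M}" for D
  have "\<exists>\<F>. finite \<F> \<and> card \<F> \<le> (m + 1) ^ (?k * L) \<and>
     (\<forall>B\<in>\<F>. list_all2 (\<subseteq>) B Ws \<and> real (card (F D \<inter> box B)) \<le> ?k * \<tau> * ?M) \<and>
     (\<forall>A. list_all2 (\<subseteq>) A Ws \<longrightarrow> real (card (F D \<inter> box A)) < (\<kappa> * \<tau>) ^ ?k * ?M \<longrightarrow>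
        (\<exists>B\<in>\<F>. list_all2 (\<lambda>a b. card (a - b) \<le> \<kappa> * m) A B))" for D
    using Cons.prems by (intro Cons.IH) auto
  then obtain \<F> where \<F>: "\<And>D. finite (\<F> D)" "\<And>D. card (\<F> D) \<le> (m + 1) ^ (?k * L)"
    "\<And>D B. B \<in> \<F> D \<Longrightarrow> list_all2 (\<subseteq>) B Ws \<and> real (card (F D \<inter> box B)) \<le> ?k * \<tau> * ?M"
    "\<And>D A. list_all2 (\<subseteq>) A Ws \<Longrightarrow> real (card (F D \<inter> box A)) < (\<kappa> * \<tau>) ^ ?k * ?M \<Longrightarrow>
        \<exists>B\<in>\<F> D. list_all2 (\<lambda>a b. card (a - b) \<le> \<kappa> * m) A B"
    by metis
  let ?S = "{D. D \<subseteq> W \<and> card D \<le> L}"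
  define \<G> where "\<G> = (\<Union>D\<in>?S. (#) (low D) ` \<F> D)"
  have finS: "finite ?S" using W(1) by simp
  show ?case
  proof (intro exI[of _ \<G>] conjI ballI allI impI)
    show "finite \<G>" unfolding \<G>_def using finS \<F>(1) by auto
    have "card \<G> \<le> (\<Sum>D\<in>?S. card ((#) (low D) ` \<F> D))"
      unfolding \<G>_def using finS by (rule card_UN_le)
    also have "\<dots> \<le> (\<Sum>D\<in>?S. (m + 1) ^ (?k * L))"
      using \<F>(1,2) by (intro sum_mono order.trans[OF card_image_le]) auto
    also have "\<dots> = card ?S * (m + 1) ^ (?k * L)" by simp
    also have "\<dots> \<le> (m + 1) ^ L * (m + 1) ^ (?k * L)"
      by (intro mult_right_mono card_small_subsets W) simp
    also have "\<dots> = (m + 1) ^ (length (W # Ws) * L)"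
      by (simp add: power_add)
    finally show "card \<G> \<le> (m + 1) ^ (length (W # Ws) * L)" .
  next
    fix B assume "B \<in> \<G>"
    then obtain D B' where B: "B = low D # B'" "B' \<in> \<F> D" unfolding \<G>_def by auto
    have B': "list_all2 (\<subseteq>) B' Ws" "real (card (F D \<inter> box B')) \<le> ?k * \<tau> * ?M"
      using \<F>(3)[OF B(2)] by auto
    have lowW: "low D \<subseteq> W" unfolding low_def by auto
    show "list_all2 (\<subseteq>) B (W # Ws)" using B B' lowW by simp
    have finlow: "finite (low D)" using lowW W(1) finite_subset by blast
    have boxB': "box B' \<subseteq> box Ws" using B'(1) by (rule box_mono)
    have finB': "finite X" if "X \<in> set B'" for X
    proof -
      obtain Y where "Y \<in> set Ws" "X \<subseteq> Y"
        using B'(1) \<open>X \<in> set B'\<close> by (metis in_set_conv_nth list_all2_conv_all_nth)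
      then show ?thesis using finWs finite_subset by blast
    qed
    have "card (T \<inter> box B) = (\<Sum>d\<in>low D. card {t \<in> box B'. d # t \<in> T})"
      unfolding B(1) using finlow finB' by (rule card_links)
    then have "real (card (T \<inter> box B)) = (\<Sum>d\<in>low D. real (card {t \<in> box B'. d # t \<in> T}))"
      by simp
    also have "\<dots> \<le> (\<Sum>d\<in>low D. \<tau> * ?M + ?k * \<tau> * ?M)"
    proof (rule sum_mono)
      fix d assume d: "d \<in> low D"
      have "{t \<in> box B'. d # t \<in> T} \<subseteq> (link d - F D) \<union> (F D \<inter> box B')"
        using boxB' unfolding link_def by auto
      then have "card {t \<in> box B'. d # t \<in> T} \<le> card (link d - F D) + card (F D \<inter> box B')"
        using finite_subset[OF linkbox finbox] finite_subset[OF Fbox finbox]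
        by (intro order.trans[OF card_mono card_Un_le]) auto
      then show "real (card {t \<in> box B'. d # t \<in> T}) \<le> \<tau> * ?M + ?k * \<tau> * ?M"
        using d B'(2) unfolding low_def by simp
    qed
    also have "\<dots> = card (low D) * (\<tau> * ?M + ?k * \<tau> * ?M)" by simp
    also have "\<dots> \<le> m * (\<tau> * ?M + ?k * \<tau> * ?M)"
      using card_mono[OF W(1) lowW] W(2) \<tau> by (intro mult_right_mono) auto
    also have "\<dots> = length (W # Ws) * \<tau> * real m ^ length (W # Ws)"
      by (simp add: algebra_simps)
    finally show "real (card (T \<inter> box B)) \<le> length (W # Ws) * \<tau> * real m ^ length (W # Ws)" .
  next
    fix A assume "list_all2 (\<subseteq>) A (W # Ws)"
      and small: "real (card (T \<inter> box A)) < (\<kappa> * \<tau>) ^ length (W # Ws) * real m ^ length (W # Ws)"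
    then obtain A0 A' where A: "A = A0 # A'" "A0 \<subseteq> W" "list_all2 (\<subseteq>) A' Ws"
      by (auto simp: list_all2_Cons2)
    have finA0: "finite A0" using A(2) W(1) finite_subset by blast
    have boxA': "box A' \<subseteq> box Ws" using A(3) by (rule box_mono)
    have finA': "finite X" if "X \<in> set A'" for X
    proof -
      obtain Y where "Y \<in> set Ws" "X \<subseteq> Y"
        using A(3) \<open>X \<in> set A'\<close> by (metis in_set_conv_nth list_all2_conv_all_nth)
      then show ?thesis using finWs finite_subset by blast
    qed
    define \<theta> where "\<theta> = \<tau> * (\<kappa> * \<tau>) ^ ?k * ?M"
    have \<theta>: "0 < \<theta>" using \<tau> \<kappa> M unfolding \<theta>_def by simp
    \<comment> \<open>At most \<open>1 / \<tau>\<close> links will be chosen, so with this \<open>\<theta>\<close> their union still satisfies the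
      hypothesis of the induction.\<close>
    define G where "G = {d \<in> A0. card (link d \<inter> box A') < \<theta>}"
    have GA: "G \<subseteq> A0" unfolding G_def by auto
    have linkA': "link d \<inter> box A' = {t \<in> box A'. d # t \<in> T}" for d
      using boxA' unfolding link_def by auto
    have "card (A0 - G) * \<theta> = (\<Sum>d\<in>A0 - G. \<theta>)" by simp
    also have "\<dots> \<le> (\<Sum>d\<in>A0 - G. real (card (link d \<inter> box A')))"
      unfolding G_def by (intro sum_mono) auto
    also have "\<dots> \<le> (\<Sum>d\<in>A0. real (card (link d \<inter> box A')))"
      using finA0 by (intro sum_mono2) auto
    also have "\<dots> = card (T \<inter> box A)"
      using card_links[OF finA0 finA', where T = T] unfolding A(1) linkA' by simp
    also have "\<dots> \<le> \<kappa> * m * \<theta>"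
      using small unfolding \<theta>_def by (simp add: algebra_simps)
    finally have exc: "card (A0 - G) \<le> \<kappa> * m" using \<theta> by simp
    have "\<exists>D \<subseteq> G. card D * (\<tau> * ?M) \<le> card (box Ws) \<and> (\<forall>d \<in> G. card (link d - (\<Union>c\<in>D. link c)) < \<tau> * ?M)"
    proof (rule greedy_cover)
      show "finite G" using GA finA0 finite_subset by blast
      show "finite (box Ws)" by (rule finbox)
    qed (use linkbox \<tau> M in auto)
    then obtain D where D: "D \<subseteq> G" "card D * (\<tau> * ?M) \<le> card (box Ws)" "\<And>d. d \<in> G \<Longrightarrow> card (link d - F D) < \<tau> * ?M"
      unfolding F_def by blast
    have "(card D * \<tau>) * ?M \<le> 1 * ?M"
      using order.trans[OF D(2) cbox] by (simp only: mult.assoc mult_1)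
    then have cD: "card D * \<tau> \<le> 1" using M by (simp only: mult_le_cancel_right_pos)
    then have "card D * \<tau> \<le> L * \<tau>" using L by linarith
    then have "card D \<le> L" using \<tau> by simp
    then have DS: "D \<in> ?S" using D GA A(2) by auto
    have finD: "finite D" by (rule finite_subset[OF order.trans[OF D(1) GA] finA0])
    have Glow: "A0 - low D \<subseteq> A0 - G"
      using D(3) GA A(2) unfolding low_def by auto
    have "real (card (F D \<inter> box A')) < (\<kappa> * \<tau>) ^ ?k * ?M"
    proof (cases "D = {}")
      case True
      then show ?thesis using \<tau> \<kappa> M unfolding F_def by simp
    next
      case False
      have "card (F D \<inter> box A') = card (\<Union>d\<in>D. link d \<inter> box A')"
        unfolding F_def by (rule arg_cong[where f = card]) auto
      also have "\<dots> \<le> (\<Sum>d\<in>D. card (link d \<inter> box A'))"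
        using finD by (rule card_UN_le)
      finally have "real (card (F D \<inter> box A')) \<le> (\<Sum>d\<in>D. real (card (link d \<inter> box A')))"
        by (simp flip: of_nat_sum)
      also have "\<dots> < (\<Sum>d\<in>D. \<theta>)"
        using finD False D(1) unfolding G_def by (intro sum_strict_mono) auto
      also have "\<dots> = (card D * \<tau>) * ((\<kappa> * \<tau>) ^ ?k * ?M)"
        unfolding \<theta>_def by (simp add: mult_ac)
      also have "\<dots> \<le> 1 * ((\<kappa> * \<tau>) ^ ?k * ?M)"
        using cD \<tau> \<kappa> M by (intro mult_right_mono) auto
      finally show ?thesis by simp
    qed
    then obtain B' where B': "B' \<in> \<F> D" "list_all2 (\<lambda>a b. card (a - b) \<le> \<kappa> * m) A' B'"
      using \<F>(4)[OF A(3)] by blast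
    have "card (A0 - low D) \<le> card (A0 - G)"
      using Glow finA0 by (intro card_mono) auto
    then have "card (A0 - low D) \<le> \<kappa> * m" using exc by linarith
    then have "list_all2 (\<lambda>a b. card (a - b) \<le> \<kappa> * m) A (low D # B')"
      using B'(2) A(1) by simp
    moreover have "low D # B' \<in> \<G>" using DS B'(1) unfolding \<G>_def by blast
    ultimately show "\<exists>B\<in>\<G>. list_all2 (\<lambda>a b. card (a - b) \<le> \<kappa> * m) A B" by blast
  qed
qed

section \<open>Colourings that avoid far lists\<close>

lemma card_constrained:
  assumes fin: "finite U" "finite R" and U': "U' \<subseteq> U"
    and R: "card R = b * y" and Q: "\<And>w. w \<in> U' \<Longrightarrow> Q w \<subseteq> R \<and> card (Q w) \<le> y" and n: "n \<le> card U'"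
    and b: "0 < b"
  shows "card {\<phi> \<in> U \<rightarrow>\<^sub>E R. \<forall>w\<in>U'. \<phi> w \<in> Q w} * b ^ n \<le> card R ^ card U"
proof -
  let ?P = "\<lambda>w. if w \<in> U' then Q w else R"
  have "{\<phi> \<in> U \<rightarrow>\<^sub>E R. \<forall>w\<in>U'. \<phi> w \<in> Q w} = PiE U ?P"
  proof
    show "{\<phi> \<in> U \<rightarrow>\<^sub>E R. \<forall>w\<in>U'. \<phi> w \<in> Q w} \<subseteq> PiE U ?P"
      by (auto simp: PiE_iff extensional_def)
    show "PiE U ?P \<subseteq> {\<phi> \<in> U \<rightarrow>\<^sub>E R. \<forall>w\<in>U'. \<phi> w \<in> Q w}"
    proof
      fix \<phi> assume \<phi>: "\<phi> \<in> PiE U ?P"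
      have "\<phi> w \<in> R" if "w \<in> U" for w
        using PiE_mem[OF \<phi> that] Q[of w] by (auto split: if_splits)
      moreover have "\<phi> w \<in> Q w" if "w \<in> U'" for w
        using PiE_mem[OF \<phi>, of w] that U' by auto
      ultimately show "\<phi> \<in> {\<phi> \<in> U \<rightarrow>\<^sub>E R. \<forall>w\<in>U'. \<phi> w \<in> Q w}"
        using \<phi> by (auto simp: PiE_iff extensional_def)
    qed
  qed
  then have "card {\<phi> \<in> U \<rightarrow>\<^sub>E R. \<forall>w\<in>U'. \<phi> w \<in> Q w} = (\<Prod>w\<in>U. card (?P w))"
    using fin(1) by (simp add: card_PiE)
  also have "\<dots> = (\<Prod>w\<in>U'. card (?P w)) * (\<Prod>w\<in>U - U'. card (?P w))"
    by (subst mult.commute) (rule prod.subset_diff[OF U' fin(1)])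
  also have "(\<Prod>w\<in>U - U'. card (?P w)) = (\<Prod>w\<in>U - U'. card R)"
    by (intro prod.cong) auto
  also have "(\<Prod>w\<in>U'. card (?P w)) \<le> (\<Prod>w\<in>U'. y)"
    using Q by (intro prod_mono) auto
  finally have "card {\<phi> \<in> U \<rightarrow>\<^sub>E R. \<forall>w\<in>U'. \<phi> w \<in> Q w} \<le> y ^ card U' * card R ^ card (U - U')"
    by simp
  then have "card {\<phi> \<in> U \<rightarrow>\<^sub>E R. \<forall>w\<in>U'. \<phi> w \<in> Q w} * b ^ n \<le> y ^ card U' * card R ^ card (U - U') * b ^ card U'"
    using n b by (intro mult_le_mono power_increasing) auto
  also have "\<dots> = card R ^ (card U' + card (U - U'))"
    by (simp add: power_add R power_mult_distrib)
  also have "card U' + card (U - U') = card U"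
    using card_Diff_subset[OF finite_subset[OF U' fin(1)] U'] card_mono[OF fin(1) U'] by simp
  finally show ?thesis .
qed

text \<open>
Colourings \<open>\<phi>\<close> of the vertices of a rich hypergraph \<open>T\<close> for which hardly any hyperedge has its list of
colours in \<open>C\<close> are rare: for every \<open>l \<in> C\<close> the box of colour classes of \<open>l\<close> is nearly independent,
so it is almost contained in a sparse container, and the containers for all \<open>l \<in> C\<close> together
determine, up to few exceptions, which colours a vertex may take.
\<close>

lemma card_poor_colourings:
  fixes \<tau> \<tau>' \<kappa> :: real and C :: "'c list set" and T :: "'a list set"
  assumes fin: "finite U" "finite R" and R: "card R = b * y" "0 < b"
    and C: "C \<subseteq> {l. length l = length Ws \<and> set l \<subseteq> R}"
    and hit: "\<And>Ys. length Ys = length Ws \<Longrightarrow> (\<And>Y. Y \<in> set Ys \<Longrightarrow> Y \<subseteq> R \<and> y \<le> card Y) \<Longrightarrow> C \<inter> box Ys \<noteq> {}"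
    and Ws: "\<And>W. W \<in> set Ws \<Longrightarrow> W \<subseteq> U \<and> card W = m" and m: "0 < m"
    and rich: "\<And>Zs. list_all2 (\<subseteq>) Zs Ws \<Longrightarrow> (\<And>Z. Z \<in> set Zs \<Longrightarrow> m \<le> 2 * card Z) \<Longrightarrow>
        \<tau> * real m ^ length Ws \<le> card (T \<inter> box Zs)"
    and \<tau>': "0 < \<tau>'" "real (card R ^ length Ws) * length Ws * \<tau>' < \<tau>"
    and \<kappa>: "0 < \<kappa>" "8 * real (card R ^ length Ws) * \<kappa> \<le> 1" and L: "1 \<le> L * \<tau>'"
  shows "card {\<phi> \<in> U \<rightarrow>\<^sub>E R. card {t \<in> T \<inter> box Ws. map \<phi> t \<in> C} < (\<kappa> * \<tau>') ^ length Ws * real m ^ length Ws}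
      * b ^ (m div 4)
    \<le> ((m + 1) ^ (length Ws * L)) ^ (card R ^ length Ws) * length Ws * 2 ^ m * card R ^ card U"
proof -
  let ?k = "length Ws"
  let ?r = "card R"
  have Wfin: "finite W" if "W \<in> set Ws" for W
    using Ws[OF that] fin(1) finite_subset by blast
  have finC: "finite C" and cardC: "card C \<le> ?r ^ ?k"
  proof -
    have eq: "{l. length l = ?k \<and> set l \<subseteq> R} = {l. set l \<subseteq> R \<and> length l = ?k}" by auto
    have f: "finite {l. length l = ?k \<and> set l \<subseteq> R}"
      unfolding eq using fin(2) by (rule finite_lists_length_eq)
    then show "finite C" by (rule finite_subset[OF C])
    show "card C \<le> ?r ^ ?k"
      using card_mono[OF f C] card_lists_length_eq[OF fin(2), of ?k] unfolding eq by simp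
  qed
  have "\<exists>\<F>. finite \<F> \<and> card \<F> \<le> (m + 1) ^ (?k * L) \<and>
     (\<forall>B\<in>\<F>. list_all2 (\<subseteq>) B Ws \<and> real (card (T \<inter> box B)) \<le> ?k * \<tau>' * real m ^ ?k) \<and>
     (\<forall>A. list_all2 (\<subseteq>) A Ws \<longrightarrow> real (card (T \<inter> box A)) < (\<kappa> * \<tau>') ^ ?k * real m ^ ?k \<longrightarrow>
        (\<exists>B\<in>\<F>. list_all2 (\<lambda>a b. card (a - b) \<le> \<kappa> * m) A B))"
    using Ws Wfin m by (intro containers \<tau>'(1) \<kappa>(1) L) auto
  then obtain \<F> where \<F>: "finite \<F>" "card \<F> \<le> (m + 1) ^ (?k * L)"
    "\<And>B. B \<in> \<F> \<Longrightarrow> list_all2 (\<subseteq>) B Ws \<and> real (card (T \<inter> box B)) \<le> ?k * \<tau>' * real m ^ ?k"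
    "\<And>A. list_all2 (\<subseteq>) A Ws \<Longrightarrow> real (card (T \<inter> box A)) < (\<kappa> * \<tau>') ^ ?k * real m ^ ?k \<Longrightarrow>
        \<exists>B\<in>\<F>. list_all2 (\<lambda>a b. card (a - b) \<le> \<kappa> * m) A B"
    by (elim exE conjE) (rule that; blast)
  \<comment> \<open>The colours that the containers \<open>B\<close> leave to a vertex \<open>w\<close> of the \<open>i\<close>-th part.\<close>
  define Q where "Q B i w = {x \<in> R. \<forall>l\<in>C. l ! i = x \<longrightarrow> w \<in> B l ! i}" for B :: "'c list \<Rightarrow> 'a set list" and i w
  \<comment> \<open>The colourings that restrict all vertices of \<open>U'\<close> to fewer than \<open>y\<close> colours.\<close>
  define S where "S B i U' = {\<phi> \<in> U \<rightarrow>\<^sub>E R. \<forall>w\<in>U'. \<phi> w \<in> (if card (Q B i w) < y then Q B i w else {})}"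
    for B :: "'c list \<Rightarrow> 'a set list" and i U'
  define I where "I = (SIGMA B:C \<rightarrow>\<^sub>E \<F>. SIGMA i:{..<?k}. {U'. U' \<subseteq> Ws ! i \<and> m div 4 \<le> card U'})"
  let ?bad = "{\<phi> \<in> U \<rightarrow>\<^sub>E R. card {t \<in> T \<inter> box Ws. map \<phi> t \<in> C} < (\<kappa> * \<tau>') ^ ?k * real m ^ ?k}"
  have finI: "finite I"
    unfolding I_def using finC \<F>(1) Wfin by (intro finite_SigmaI finite_PiE) auto
  have "card I = (\<Sum>B\<in>C \<rightarrow>\<^sub>E \<F>. \<Sum>i<?k. card {U'. U' \<subseteq> Ws ! i \<and> m div 4 \<le> card U'})"
    unfolding I_def using finC \<F>(1) Wfin
    by (subst card_SigmaI) (auto intro!: finite_PiE finite_SigmaI sum.cong card_SigmaI)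
  also have "\<dots> \<le> (\<Sum>B\<in>C \<rightarrow>\<^sub>E \<F>. \<Sum>i<?k. 2 ^ m)"
  proof (intro sum_mono)
    fix i assume "i \<in> {..<?k}"
    then have W: "finite (Ws ! i)" "card (Ws ! i) = m" using Ws Wfin by auto
    have "card {U'. U' \<subseteq> Ws ! i \<and> m div 4 \<le> card U'} \<le> card (Pow (Ws ! i))"
      using W(1) by (intro card_mono) auto
    then show "card {U'. U' \<subseteq> Ws ! i \<and> m div 4 \<le> card U'} \<le> 2 ^ m"
      using W by (simp add: card_Pow)
  qed
  also have "\<dots> = card \<F> ^ card C * ?k * 2 ^ m"
    using finC by (simp add: card_PiE)
  also have "\<dots> \<le> ((m + 1) ^ (?k * L)) ^ (?r ^ ?k) * ?k * 2 ^ m"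
  proof -
    have "card \<F> ^ card C \<le> ((m + 1) ^ (?k * L)) ^ card C"
      using \<F>(2) by (rule power_mono) simp
    also have "\<dots> \<le> ((m + 1) ^ (?k * L)) ^ (?r ^ ?k)"
      using cardC by (rule power_increasing) simp
    finally show ?thesis by simp
  qed
  finally have cardI: "card I \<le> ((m + 1) ^ (?k * L)) ^ (?r ^ ?k) * ?k * 2 ^ m" .
  have cover: "?bad \<subseteq> (\<Union>(B, i, U')\<in>I. S B i U')"
  proof
    fix \<phi> assume "\<phi> \<in> ?bad"
    then have \<phi>: "\<phi> \<in> U \<rightarrow>\<^sub>E R"
      and few: "card {t \<in> T \<inter> box Ws. map \<phi> t \<in> C} < (\<kappa> * \<tau>') ^ ?k * real m ^ ?k" by auto
    define A where "A l = map (\<lambda>i. {w \<in> Ws ! i. \<phi> w = l ! i}) [0..<?k]" for l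
    have A: "list_all2 (\<subseteq>) (A l) Ws" for l
      unfolding A_def by (auto simp: list_all2_conv_all_nth)
    have "\<exists>B\<in>\<F>. list_all2 (\<lambda>a b. card (a - b) \<le> \<kappa> * m) (A l) B" if l: "l \<in> C" for l
    proof (rule \<F>(4)[OF A])
      have "T \<inter> box (A l) \<subseteq> {t \<in> T \<inter> box Ws. map \<phi> t \<in> C}"
      proof
        fix t assume t: "t \<in> T \<inter> box (A l)"
        then have "t \<in> box Ws" using box_mono[OF A] by blast
        moreover have "map \<phi> t = l"
          using t l C unfolding box_def A_def
          by (intro nth_equalityI) (auto simp: list_all2_conv_all_nth)
        ultimately show "t \<in> {t \<in> T \<inter> box Ws. map \<phi> t \<in> C}" using t l by auto
      qed
      moreover have "finite (box Ws)" using Wfin by (rule finite_box)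
      ultimately have "card (T \<inter> box (A l)) \<le> card {t \<in> T \<inter> box Ws. map \<phi> t \<in> C}"
        by (intro card_mono) auto
      then show "real (card (T \<inter> box (A l))) < (\<kappa> * \<tau>') ^ ?k * real m ^ ?k"
        using few by linarith
    qed
    then obtain B0 where B0: "\<And>l. l \<in> C \<Longrightarrow> B0 l \<in> \<F> \<and> list_all2 (\<lambda>a b. card (a - b) \<le> \<kappa> * m) (A l) (B0 l)"
      by metis
    define B where "B = restrict B0 C"
    have B: "B \<in> C \<rightarrow>\<^sub>E \<F>" using B0 unfolding B_def by auto
    have BC: "B l \<in> \<F>" "list_all2 (\<lambda>a b. card (a - b) \<le> \<kappa> * m) (A l) (B l)" if "l \<in> C" for l
      using B0[OF that] that unfolding B_def by auto
    define Z where "Z i = {w \<in> Ws ! i. y \<le> card (Q B i w)}" for i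
    \<comment> \<open>If half of the vertices in every part were left with \<open>y\<close> colours, then any transversal of these
      halves could be coloured by some \<open>l \<in> C\<close> and so lie in the container of \<open>l\<close>. The containers would
      cover a rich box.\<close>
    have "\<exists>i<?k. 2 * card (Z i) < m"
    proof (rule ccontr)
      assume "\<not> (\<exists>i<?k. 2 * card (Z i) < m)"
      then have big: "m \<le> 2 * card (Z i)" if "i < ?k" for i using that not_less by blast
      let ?Zs = "map Z [0..<?k]"
      have sub: "list_all2 (\<subseteq>) ?Zs Ws"
        unfolding Z_def by (auto simp: list_all2_conv_all_nth)
      have "\<tau> * real m ^ ?k \<le> card (T \<inter> box ?Zs)"
        using sub big by (intro rich) auto
      also have "\<dots> \<le> (\<Sum>l\<in>C. card (T \<inter> box (B l)))"
      proof -
        have "T \<inter> box ?Zs \<subseteq> (\<Union>l\<in>C. T \<inter> box (B l))"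
        proof
          fix t assume t: "t \<in> T \<inter> box ?Zs"
          then have tl: "length t = ?k" and tZ: "\<And>i. i < ?k \<Longrightarrow> t ! i \<in> Z i"
            unfolding box_def by (auto simp: list_all2_conv_all_nth)
          let ?Ys = "map (\<lambda>i. Q B i (t ! i)) [0..<?k]"
          have "C \<inter> box ?Ys \<noteq> {}"
            using tZ by (intro hit) (auto simp: Z_def Q_def)
          then obtain l where l: "l \<in> C" "l \<in> box ?Ys" by blast
          have "length (B l) = ?k"
            using \<F>(3)[OF BC(1)[OF l(1)]] by (auto dest: list_all2_lengthD)
          moreover have "t ! i \<in> B l ! i" if "i < ?k" for i
          proof -
            have "l ! i \<in> Q B i (t ! i)"
              using l(2) that unfolding box_def by (auto simp: list_all2_conv_all_nth)
            then show ?thesis using l(1) unfolding Q_def by blast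
          qed
          ultimately have "t \<in> box (B l)"
            using tl unfolding box_def by (auto simp: list_all2_conv_all_nth)
          then show "t \<in> (\<Union>l\<in>C. T \<inter> box (B l))" using t l(1) by blast
        qed
        moreover have "finite (\<Union>l\<in>C. T \<inter> box (B l))"
        proof -
          have "finite (box (B l))" if "l \<in> C" for l
            using box_mono \<F>(3)[OF BC(1)[OF that]] finite_box[OF Wfin] finite_subset by blast
          then show ?thesis using finC by auto
        qed
        ultimately have "card (T \<inter> box ?Zs) \<le> card (\<Union>l\<in>C. T \<inter> box (B l))"
          by (intro card_mono)
        also have "\<dots> \<le> (\<Sum>l\<in>C. card (T \<inter> box (B l)))" using finC by (rule card_UN_le)
        finally show ?thesis by (simp only: of_nat_le_iff)
      qed
      also have "\<dots> = (\<Sum>l\<in>C. real (card (T \<inter> box (B l))))" by simp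
      also have "\<dots> \<le> (\<Sum>l\<in>C. ?k * \<tau>' * real m ^ ?k)"
        using \<F>(3) BC(1) by (intro sum_mono) auto
      also have "\<dots> = real (card C) * (?k * \<tau>' * real m ^ ?k)" by simp
      also have "\<dots> \<le> real (?r ^ ?k) * (?k * \<tau>' * real m ^ ?k)"
        using cardC \<tau>'(1) by (intro mult_right_mono) (simp_all flip: of_nat_power)
      also have "\<dots> = (real (?r ^ ?k) * ?k * \<tau>') * real m ^ ?k" by (simp only: mult.assoc)
      also have "\<dots> < \<tau> * real m ^ ?k"
        using \<tau>'(2) m by (intro mult_strict_right_mono) auto
      finally show False by simp
    qed
    then obtain i where i: "i < ?k" "2 * card (Z i) < m" by blast
    have Wi: "finite (Ws ! i)" "card (Ws ! i) = m" "Ws ! i \<subseteq> U"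
      using Ws[of "Ws ! i"] Wfin[of "Ws ! i"] i(1) by auto
    \<comment> \<open>The vertices that violate the restrictions because their colour class is not fully contained in its
      container.\<close>
    define X where "X = (\<Union>l\<in>C. A l ! i - B l ! i)"
    have finX: "finite X" unfolding X_def A_def using finC i(1) Wi(1) by auto
    have "real (card X) \<le> real (\<Sum>l\<in>C. card (A l ! i - B l ! i))"
      unfolding X_def using card_UN_le[OF finC] by (simp only: of_nat_le_iff)
    also have "\<dots> = (\<Sum>l\<in>C. real (card (A l ! i - B l ! i)))" by simp
    also have "\<dots> \<le> (\<Sum>l\<in>C. \<kappa> * m)"
    proof (rule sum_mono)
      fix l assume "l \<in> C"
      moreover have "i < length (A l)" using i(1) unfolding A_def by simp
      ultimately show "real (card (A l ! i - B l ! i)) \<le> \<kappa> * m"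
        using BC(2)[of l] list_all2_nthD by fastforce
    qed
    also have "\<dots> = real (card C) * (\<kappa> * m)" by simp
    also have "\<dots> \<le> real (?r ^ ?k) * (\<kappa> * m)"
      using cardC \<kappa>(1) by (intro mult_right_mono) (simp_all flip: of_nat_power)
    finally have "8 * real (card X) \<le> (8 * real (?r ^ ?k) * \<kappa>) * m" by (simp add: mult_ac)
    also have "\<dots> \<le> 1 * real m" using \<kappa>(2) by (intro mult_right_mono) auto
    finally have cX: "8 * card X \<le> m" by simp
    define U' where "U' = Ws ! i - Z i - X"
    have Zsub: "Z i \<subseteq> Ws ! i" unfolding Z_def by auto
    have "card (Ws ! i) - card (Z i) - card X \<le> card U'"
      unfolding U'_def using Wi(1) Zsub finX
      by (metis card_Diff_subset diff_card_le_card_Diff finite_subset)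
    then have "m div 4 \<le> card U'" using Wi(2) i(2) cX by linarith
    moreover have "\<phi> w \<in> (if card (Q B i w) < y then Q B i w else {})" if w: "w \<in> U'" for w
    proof -
      have wW: "w \<in> Ws ! i" "w \<notin> Z i" "w \<notin> X" using w unfolding U'_def by auto
      have "card (Q B i w) < y" using wW unfolding Z_def by auto
      moreover have "w \<in> B l ! i" if "l \<in> C" "l ! i = \<phi> w" for l
      proof (rule ccontr)
        assume "w \<notin> B l ! i"
        moreover have "w \<in> A l ! i" using wW(1) that(2) i(1) unfolding A_def by simp
        ultimately show False using wW(3) that(1) unfolding X_def by blast
      qed
      moreover have "\<phi> w \<in> R" using \<phi> wW(1) Wi(3) by (auto simp: PiE_iff)
      ultimately show ?thesis unfolding Q_def by auto
    qed
    ultimately have "(B, i, U') \<in> I" "\<phi> \<in> S B i U'"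
      using B i(1) \<phi> unfolding I_def S_def U'_def by auto
    then show "\<phi> \<in> (\<Union>(B, i, U')\<in>I. S B i U')" by blast
  qed
  have finR: "finite (U \<rightarrow>\<^sub>E R)" using fin by (intro finite_PiE) auto
  have "card ?bad \<le> card (\<Union>(B, i, U')\<in>I. S B i U')"
    using finI finR by (intro card_mono cover) (auto simp: S_def intro: finite_subset)
  also have "\<dots> \<le> (\<Sum>x\<in>I. card (case x of (B, i, U') \<Rightarrow> S B i U'))"
    using finI by (rule card_UN_le)
  finally have "card ?bad * b ^ (m div 4) \<le> (\<Sum>x\<in>I. card (case x of (B, i, U') \<Rightarrow> S B i U')) * b ^ (m div 4)"
    by (rule mult_le_mono1)
  also have "\<dots> = (\<Sum>x\<in>I. card (case x of (B, i, U') \<Rightarrow> S B i U') * b ^ (m div 4))"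
    by (rule sum_distrib_right)
  also have "\<dots> \<le> (\<Sum>x\<in>I. ?r ^ card U)"
  proof (rule sum_mono)
    fix x assume "x \<in> I"
    then obtain B i U' where x: "x = (B, i, U')" "i < ?k" "U' \<subseteq> Ws ! i" "m div 4 \<le> card U'"
      unfolding I_def by auto
    have "U' \<subseteq> U" using x(2,3) Ws[of "Ws ! i"] by auto
    then have "card (S B i U') * b ^ (m div 4) \<le> ?r ^ card U"
      unfolding S_def using R x(4) by (intro card_constrained[OF fin]) (auto simp: Q_def)
    then show "card (case x of (B, i, U') \<Rightarrow> S B i U') * b ^ (m div 4) \<le> ?r ^ card U"
      using x(1) by simp
  qed
  also have "\<dots> = card I * ?r ^ card U" by simp
  also have "\<dots> \<le> ((m + 1) ^ (?k * L)) ^ (?r ^ ?k) * ?k * 2 ^ m * ?r ^ card U"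
    by (rule mult_le_mono1[OF cardI])
  finally show ?thesis .
qed

section \<open>A random colouring of the pairs\<close>

text \<open>
A counting version of conditional probability: if changing \<open>f\<close> on \<open>D\<close> preserves \<open>Q\<close> and makes
\<open>Bad\<close> true with probability at most \<open>y / x\<close>, then the probability of \<open>Bad\<close> given \<open>Q\<close> is at most
\<open>y / x\<close>. The proof exchanges the values on \<open>D\<close> with a second, independent choice of them.
\<close>

lemma card_override:
  fixes P :: "'a set" and R :: "'b set"
  assumes fin: "finite P" "finite R" "R \<noteq> {}" and D: "D \<subseteq> P"
    and Q: "\<And>f g. f \<in> P \<rightarrow>\<^sub>E R \<Longrightarrow> g \<in> D \<rightarrow>\<^sub>E R \<Longrightarrow> Q f \<Longrightarrow> Q (override_on f g D)"
    and Bad: "\<And>f. f \<in> P \<rightarrow>\<^sub>E R \<Longrightarrow> Q f \<Longrightarrow>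
      card {g \<in> D \<rightarrow>\<^sub>E R. Bad (override_on f g D)} * x \<le> y * card R ^ card D"
  shows "card {f \<in> P \<rightarrow>\<^sub>E R. Q f \<and> Bad f} * x \<le> y * card {f \<in> P \<rightarrow>\<^sub>E R. Q f}"
proof -
  let ?G = "{f \<in> P \<rightarrow>\<^sub>E R. Q f}"
  let ?B = "{f \<in> P \<rightarrow>\<^sub>E R. Q f \<and> Bad f}"
  let ?E = "D \<rightarrow>\<^sub>E R"
  let ?X = "SIGMA f:?G. {g \<in> ?E. Bad (override_on f g D)}"
  \<comment> \<open>Exchanging the values on \<open>D\<close> is an involution.\<close>
  let ?h = "\<lambda>(f, g). (override_on f g D, restrict f D)"
  have finD: "finite D" using D fin(1) finite_subset by blast
  have finG: "finite ?G" "finite ?E" using fin finD by (auto intro!: finite_PiE)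
  have ov: "override_on f g D \<in> P \<rightarrow>\<^sub>E R" if "f \<in> P \<rightarrow>\<^sub>E R" "g \<in> ?E" for f g
    using that D by (auto simp: PiE_iff override_on_def extensional_def)
  have re: "f x \<in> R" if "f \<in> P \<rightarrow>\<^sub>E R" "x \<in> D" for f x
    using that D by (auto simp: PiE_iff)
  have inv: "override_on (override_on f g D) (restrict f D) D = f" for f g
    by (auto simp: override_on_def)
  have inv2: "restrict (override_on f g D) D = g" if "g \<in> ?E" for f g
    using that by (auto simp: override_on_def restrict_def PiE_iff extensional_def)
  have "bij_betw ?h ?X (?B \<times> ?E)"
  proof (rule bij_betw_byWitness[where f' = ?h])
    show "\<forall>p\<in>?X. ?h (?h p) = p" using inv inv2 by auto
    show "\<forall>p\<in>?B \<times> ?E. ?h (?h p) = p" using inv inv2 by auto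
    show "?h ` ?X \<subseteq> ?B \<times> ?E" using ov re Q by auto
    show "?h ` (?B \<times> ?E) \<subseteq> ?X" using ov re Q by (auto simp: inv)
  qed
  then have "card ?B * card ?E = card ?X"
    by (simp add: bij_betw_same_card card_cartesian_product)
  also have "\<dots> = (\<Sum>f\<in>?G. card {g \<in> ?E. Bad (override_on f g D)})"
    using finG by (intro card_SigmaI) auto
  finally have "card ?B * card ?E * x = (\<Sum>f\<in>?G. card {g \<in> ?E. Bad (override_on f g D)} * x)"
    by (simp add: sum_distrib_right)
  also have "\<dots> \<le> (\<Sum>f\<in>?G. y * card R ^ card D)"
    using Bad by (intro sum_mono) auto
  also have "\<dots> = card ?G * y * card ?E"
    using finD by (simp add: card_PiE)
  finally have "(card ?B * x) * card ?E \<le> (y * card ?G) * card ?E"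
    by (simp add: mult_ac)
  moreover have "0 < card ?E"
    using fin finD by (simp add: card_PiE card_gt_0_iff)
  ultimately show ?thesis by (simp only: mult_le_cancel2)
qed

lemma card_override_all:
  fixes P :: "'a set" and R :: "'b set"
  assumes fin: "finite P" "finite R" "R \<noteq> {}" and A: "finite A" and D: "\<And>a. a \<in> A \<Longrightarrow> D a \<subseteq> P"
    and Q: "\<And>a f g. a \<in> A \<Longrightarrow> f \<in> P \<rightarrow>\<^sub>E R \<Longrightarrow> g \<in> D a \<rightarrow>\<^sub>E R \<Longrightarrow> Q f \<Longrightarrow> Q (override_on f g (D a))"
    and Bad: "\<And>a f. a \<in> A \<Longrightarrow> f \<in> P \<rightarrow>\<^sub>E R \<Longrightarrow> Q f \<Longrightarrow>
      card {g \<in> D a \<rightarrow>\<^sub>E R. Bad a (override_on f g (D a))} * x \<le> y * card R ^ card (D a)"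
    and indep: "\<And>a a' f g. a \<in> A \<Longrightarrow> a' \<in> A \<Longrightarrow> a \<noteq> a' \<Longrightarrow> Bad a (override_on f g (D a')) = Bad a f"
  shows "card {f \<in> P \<rightarrow>\<^sub>E R. Q f \<and> (\<forall>a\<in>A. Bad a f)} * x ^ card A \<le> y ^ card A * card (P \<rightarrow>\<^sub>E R)"
  using A D Q Bad indep
proof (induction A)
  case empty
  have "card {f \<in> P \<rightarrow>\<^sub>E R. Q f} \<le> card (P \<rightarrow>\<^sub>E R)"
    using fin by (intro card_mono finite_PiE) auto
  then show ?case by simp
next
  case (insert a A)
  let ?Q = "\<lambda>f. Q f \<and> (\<forall>a\<in>A. Bad a f)"
  have IH: "card {f \<in> P \<rightarrow>\<^sub>E R. ?Q f} * x ^ card A \<le> y ^ card A * card (P \<rightarrow>\<^sub>E R)"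
    by (rule insert.IH) (use insert.prems in auto)
  have "card {f \<in> P \<rightarrow>\<^sub>E R. ?Q f \<and> Bad a f} * x \<le> y * card {f \<in> P \<rightarrow>\<^sub>E R. ?Q f}"
  proof (rule card_override[OF fin])
    show "D a \<subseteq> P" using insert.prems(1) by simp
    show "?Q (override_on f g (D a))" if "f \<in> P \<rightarrow>\<^sub>E R" "g \<in> D a \<rightarrow>\<^sub>E R" "?Q f" for f g
    proof (intro conjI ballI)
      show "Q (override_on f g (D a))" using insert.prems(2)[of a f g] that by simp
      fix a' assume "a' \<in> A"
      then show "Bad a' (override_on f g (D a))"
        using insert.prems(4)[of a' a f g] insert.hyps(2) that by auto
    qed
    show "card {g \<in> D a \<rightarrow>\<^sub>E R. Bad a (override_on f g (D a))} * x \<le> y * card R ^ card (D a)"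
      if "f \<in> P \<rightarrow>\<^sub>E R" "?Q f" for f
      using insert.prems(3)[of a f] that by simp
  qed
  moreover have "{f \<in> P \<rightarrow>\<^sub>E R. ?Q f \<and> Bad a f} = {f \<in> P \<rightarrow>\<^sub>E R. Q f \<and> (\<forall>a\<in>insert a A. Bad a f)}"
    by auto
  ultimately have "card {f \<in> P \<rightarrow>\<^sub>E R. Q f \<and> (\<forall>a\<in>insert a A. Bad a f)} * x
      \<le> y * card {f \<in> P \<rightarrow>\<^sub>E R. ?Q f}" by simp
  then have "card {f \<in> P \<rightarrow>\<^sub>E R. Q f \<and> (\<forall>a\<in>insert a A. Bad a f)} * x * x ^ card A
      \<le> y * card {f \<in> P \<rightarrow>\<^sub>E R. ?Q f} * x ^ card A" by (rule mult_le_mono1)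
  also have "\<dots> = y * (card {f \<in> P \<rightarrow>\<^sub>E R. ?Q f} * x ^ card A)" by (simp only: mult.assoc)
  also have "\<dots> \<le> y * (y ^ card A * card (P \<rightarrow>\<^sub>E R))" by (rule mult_le_mono2[OF IH])
  finally show ?case using insert.hyps by (simp add: mult.assoc)
qed

definition pairs :: "nat \<Rightarrow> (nat \<times> nat) set" where
  "pairs N = {(a, b). a < b \<and> b < N}"

lemma finite_pairs [simp]: "finite (pairs N)"
  by (rule finite_subset[of _ "{..<N} \<times> {..<N}"]) (auto simp: pairs_def)

text \<open>
For increasing lists this says that the vertices form a clique in the \<open>3\<close>-graph of the triples
\<open>a < b < c\<close> for which the colours of \<open>(a, b)\<close> and \<open>(a, c)\<close> are far.
\<close>

fun far_clique :: "nat \<Rightarrow> (nat \<times> nat \<Rightarrow> nat list) \<Rightarrow> nat list \<Rightarrow> bool" where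
  "far_clique q \<chi> [] \<longleftrightarrow> True"
| "far_clique q \<chi> (a # t) \<longleftrightarrow> far_clique q \<chi> t \<and> sorted_wrt (far q) (map (\<lambda>b. \<chi> (a, b)) t)"

definition increasing :: "nat set list \<Rightarrow> bool" where
  "increasing Ws \<longleftrightarrow> sorted_wrt (\<lambda>A B. \<forall>a\<in>A. \<forall>b\<in>B. a < b) Ws"

lemma far_clique_cong:
  assumes "\<And>a b. a \<in> set t \<Longrightarrow> b \<in> set t \<Longrightarrow> \<chi> (a, b) = \<chi>' (a, b)"
  shows "far_clique q \<chi> t = far_clique q \<chi>' t"
  using assms
proof (induction t)
  case (Cons a t)
  have "map (\<lambda>b. \<chi> (a, b)) t = map (\<lambda>b. \<chi>' (a, b)) t" using Cons.prems by auto
  moreover have "far_clique q \<chi> t = far_clique q \<chi>' t" using Cons by auto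
  ultimately show ?case by (simp only: far_clique.simps)
qed simp

lemma set_box: "t \<in> box Ws \<Longrightarrow> set t \<subseteq> \<Union> (set Ws)"
  unfolding box_def by (auto simp: list_all2_conv_all_nth in_set_conv_nth) (metis nth_mem)

text \<open>
The density is required for all boxes that keep half of every part, since this is what a covering by
few sparse containers would contradict.
\<close>

definition rich :: "nat \<Rightarrow> real \<Rightarrow> nat \<Rightarrow> nat set list \<Rightarrow> (nat \<times> nat \<Rightarrow> nat list) \<Rightarrow> bool" where
  "rich q \<tau> m Ws \<chi> \<longleftrightarrow> (\<forall>Zs. list_all2 (\<subseteq>) Zs Ws \<longrightarrow> (\<forall>Z \<in> set Zs. m \<le> 2 * card Z) \<longrightarrow>
     \<tau> * real m ^ length Ws \<le> card ({t. far_clique q \<chi> t} \<inter> box Zs))"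

text \<open>
Given that \<open>Ws\<close> is rich, the extended box \<open>W0 # Ws\<close> can only be poor if half of the vertices in \<open>W0\<close>
see few cliques with pairwise far colours. The pairs from different vertices of \<open>W0\<close> to \<open>Ws\<close> are coloured
independently of each other and of the cliques within \<open>Ws\<close>, so the bounds for single vertices multiply.
\<close>

lemma card_rich_poor:
  fixes \<tau> \<tau>' \<kappa> :: real
  assumes q: "0 < q" and R: "q ^ d = b * y" "0 < b"
    and hit: "\<And>Ys. length Ys = length Ws \<Longrightarrow> (\<And>Y. Y \<in> set Ys \<Longrightarrow> Y \<subseteq> words q d \<and> y \<le> card Y) \<Longrightarrow>
      far_lists q d (length Ws) \<inter> box Ys \<noteq> {}"
    and Ws: "\<And>W. W \<in> set (W0 # Ws) \<Longrightarrow> W \<subseteq> {..<N} \<and> card W = m" and m: "0 < m"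
    and inc: "increasing (W0 # Ws)"
    and \<tau>': "0 < \<tau>'" "real ((q ^ d) ^ length Ws) * length Ws * \<tau>' < \<tau>"
    and \<kappa>: "0 < \<kappa>" "8 * real ((q ^ d) ^ length Ws) * \<kappa> \<le> 1" and L: "1 \<le> L * \<tau>'"
  shows "card {\<chi> \<in> pairs N \<rightarrow>\<^sub>E words q d. rich q \<tau> m Ws \<chi> \<and>
        2 * card ({t. far_clique q \<chi> t} \<inter> box (W0 # Ws)) < (\<kappa> * \<tau>') ^ length Ws * real m ^ length (W0 # Ws)}
      * (b ^ (m div 4)) ^ (m div 2)
    \<le> 2 ^ m * (((m + 1) ^ (length Ws * L)) ^ ((q ^ d) ^ length Ws) * length Ws * 2 ^ m) ^ (m div 2)
      * card (pairs N \<rightarrow>\<^sub>E words q d)"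
proof -
  let ?k = "length Ws"
  let ?\<Omega> = "pairs N \<rightarrow>\<^sub>E words q d"
  let ?F = "((m + 1) ^ (?k * L)) ^ ((q ^ d) ^ ?k) * ?k * 2 ^ m"
  let ?\<theta> = "(\<kappa> * \<tau>') ^ ?k * real m ^ ?k"
  define U where "U = \<Union> (set Ws)"
  have finW0: "finite W0" "card W0 = m" "W0 \<subseteq> {..<N}" using Ws[of W0] finite_subset by auto
  have finWs: "finite W" if "W \<in> set Ws" for W using Ws[of W] that finite_subset by auto
  have finU: "finite U" and UN: "U \<subseteq> {..<N}" unfolding U_def using finWs Ws by auto
  have below: "a < b" if "a \<in> W0" "b \<in> U" for a b
    using inc that unfolding increasing_def U_def by auto
  define bad where "bad a \<chi> \<longleftrightarrow>
      card {t \<in> {t. far_clique q \<chi> t} \<inter> box Ws. map (\<lambda>b. \<chi> (a, b)) t \<in> far_lists q d ?k} < ?\<theta>" for a \<chi>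
  have R': "words q d \<noteq> {}" "card (words q d) = b * y"
    using q R(1) card_words[of q d] by (metis card.empty power_not_zero less_irrefl, simp)
  have same: "far_clique q (override_on f g ({a} \<times> U)) t = far_clique q f t"
    if "a \<in> W0" "t \<in> box Ws" for a f g t
  proof (rule far_clique_cong)
    fix x y assume "x \<in> set t" "y \<in> set t"
    then have "x \<in> U" using set_box[OF that(2)] unfolding U_def by auto
    then have "x \<noteq> a" using below that(1) by blast
    then show "override_on f g ({a} \<times> U) (x, y) = f (x, y)" by (simp add: override_on_def)
  qed
  have one: "card {\<chi> \<in> ?\<Omega>. rich q \<tau> m Ws \<chi> \<and> (\<forall>a\<in>A. bad a \<chi>)} * (b ^ (m div 4)) ^ card A
      \<le> ?F ^ card A * card ?\<Omega>" if A: "A \<subseteq> W0" for A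
  proof (rule card_override_all[where D = "\<lambda>a. {a} \<times> U"])
    show "finite A" using A finW0(1) finite_subset by blast
    fix a assume "a \<in> A"
    then have a: "a \<in> W0" using A by blast
    show "{a} \<times> U \<subseteq> pairs N"
      using below[OF a] UN unfolding pairs_def by auto
    show "rich q \<tau> m Ws (override_on f g ({a} \<times> U))" if "rich q \<tau> m Ws f" for f g
      unfolding rich_def
    proof (intro allI impI)
      fix Zs assume Zs: "list_all2 (\<subseteq>) Zs Ws" "\<forall>Z \<in> set Zs. m \<le> 2 * card Z"
      have "{t. far_clique q (override_on f g ({a} \<times> U)) t} \<inter> box Zs = {t. far_clique q f t} \<inter> box Zs"
        using same[OF a] box_mono[OF Zs(1)] by auto
      then show "\<tau> * real m ^ ?k \<le> card ({t. far_clique q (override_on f g ({a} \<times> U)) t} \<inter> box Zs)"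
        using that Zs unfolding rich_def by simp
    qed
    show "bad a (override_on f g ({a'} \<times> U)) = bad a f" if "a' \<in> A" "a \<noteq> a'" for a' f g
    proof -
      have "a' \<in> W0" using that(1) A by blast
      then have "{t \<in> {t. far_clique q (override_on f g ({a'} \<times> U)) t} \<inter> box Ws.
          map (\<lambda>b. override_on f g ({a'} \<times> U) (a, b)) t \<in> far_lists q d ?k}
        = {t \<in> {t. far_clique q f t} \<inter> box Ws. map (\<lambda>b. f (a, b)) t \<in> far_lists q d ?k}"
        using same that(2) by (auto simp: override_on_def)
      then show ?thesis unfolding bad_def by simp
    qed
    fix f assume f: "rich q \<tau> m Ws f"
    let ?T = "{t. far_clique q f t}"
    let ?D = "{a} \<times> U"
    let ?P = "\<lambda>\<phi>. card {t \<in> ?T \<inter> box Ws. map \<phi> t \<in> far_lists q d ?k} < ?\<theta>"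
    have "card {g \<in> ?D \<rightarrow>\<^sub>E words q d. bad a (override_on f g ?D)}
        \<le> card {\<phi> \<in> U \<rightarrow>\<^sub>E words q d. ?P \<phi>}"
    proof (rule card_inj_on_le[where f = "\<lambda>g. \<lambda>b\<in>U. g (a, b)"])
      show "inj_on (\<lambda>g. \<lambda>b\<in>U. g (a, b)) {g \<in> ?D \<rightarrow>\<^sub>E words q d. bad a (override_on f g ?D)}"
      proof (rule inj_onI)
        fix g g' assume g: "g \<in> {g \<in> ?D \<rightarrow>\<^sub>E words q d. bad a (override_on f g ?D)}"
          "g' \<in> {g \<in> ?D \<rightarrow>\<^sub>E words q d. bad a (override_on f g ?D)}"
          and eq: "(\<lambda>b\<in>U. g (a, b)) = (\<lambda>b\<in>U. g' (a, b))"
        have "g (a, b) = g' (a, b)" if "b \<in> U" for b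
          using fun_cong[OF eq, of b] that by simp
        then show "g = g'" using g by (intro PiE_ext[where k = ?D]) auto
      qed
      show "(\<lambda>g. \<lambda>b\<in>U. g (a, b)) ` {g \<in> ?D \<rightarrow>\<^sub>E words q d. bad a (override_on f g ?D)}
          \<subseteq> {\<phi> \<in> U \<rightarrow>\<^sub>E words q d. ?P \<phi>}"
      proof
        fix \<phi> assume "\<phi> \<in> (\<lambda>g. \<lambda>b\<in>U. g (a, b)) ` {g \<in> ?D \<rightarrow>\<^sub>E words q d. bad a (override_on f g ?D)}"
        then obtain g where g: "g \<in> ?D \<rightarrow>\<^sub>E words q d" "bad a (override_on f g ?D)"
          "\<phi> = (\<lambda>b\<in>U. g (a, b))" by auto
        have mp: "map (\<lambda>b. override_on f g ?D (a, b)) t = map \<phi> t" if "t \<in> box Ws" for t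
          using set_box[OF that] unfolding g(3) U_def by (auto simp: override_on_def)
        have "{t \<in> {t. far_clique q (override_on f g ?D) t} \<inter> box Ws.
            map (\<lambda>b. override_on f g ?D (a, b)) t \<in> far_lists q d ?k}
          = {t \<in> ?T \<inter> box Ws. map \<phi> t \<in> far_lists q d ?k}"
          by (auto simp: mp same[OF a])
        then have "?P \<phi>" using g(2) unfolding bad_def by simp
        moreover have "\<phi> \<in> U \<rightarrow>\<^sub>E words q d" using g(1,3) by (auto simp: PiE_iff)
        ultimately show "\<phi> \<in> {\<phi> \<in> U \<rightarrow>\<^sub>E words q d. ?P \<phi>}" by simp
      qed
      show "finite {\<phi> \<in> U \<rightarrow>\<^sub>E words q d. ?P \<phi>}"
        using finite_PiE[OF finU, of "\<lambda>_. words q d"] by simp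
    qed
    then have "card {g \<in> ?D \<rightarrow>\<^sub>E words q d. bad a (override_on f g ?D)} * b ^ (m div 4)
        \<le> card {\<phi> \<in> U \<rightarrow>\<^sub>E words q d. ?P \<phi>} * b ^ (m div 4)" by (rule mult_le_mono1)
    also have "\<dots> \<le> ((m + 1) ^ (?k * L)) ^ (card (words q d) ^ ?k) * ?k * 2 ^ m * card (words q d) ^ card U"
    proof (rule card_poor_colourings[OF finU finite_words R'(2) R(2)])
      show "far_lists q d ?k \<subseteq> {l. length l = ?k \<and> set l \<subseteq> words q d}"
        unfolding far_lists_def by auto
      show "W \<subseteq> U \<and> card W = m" if "W \<in> set Ws" for W
        using Ws[of W] that unfolding U_def by auto
      show "\<tau> * real m ^ ?k \<le> card (?T \<inter> box Zs)"
        if "list_all2 (\<subseteq>) Zs Ws" "\<And>Z. Z \<in> set Zs \<Longrightarrow> m \<le> 2 * card Z" for Zs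
        using f that unfolding rich_def by blast
    qed (use hit m \<tau>' \<kappa> L in auto)
    also have "card U = card ?D" by (simp add: card_cartesian_product_singleton)
    finally show "card {g \<in> ?D \<rightarrow>\<^sub>E words q d. bad a (override_on f g ?D)} * b ^ (m div 4)
        \<le> ?F * card (words q d) ^ card ?D" by simp
  qed (use R' in auto)
  let ?S = "{A. A \<subseteq> W0 \<and> card A = m div 2}"
  let ?G = "\<lambda>A. {\<chi> \<in> ?\<Omega>. rich q \<tau> m Ws \<chi> \<and> (\<forall>a\<in>A. bad a \<chi>)}"
  let ?E = "{\<chi> \<in> ?\<Omega>. rich q \<tau> m Ws \<chi> \<and>
        2 * card ({t. far_clique q \<chi> t} \<inter> box (W0 # Ws)) < (\<kappa> * \<tau>') ^ ?k * real m ^ length (W0 # Ws)}"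
  have fin\<Omega>: "finite ?\<Omega>" by (intro finite_PiE) auto
  have "?E \<subseteq> (\<Union>A\<in>?S. ?G A)"
  proof
    fix \<chi> assume \<chi>: "\<chi> \<in> ?E"
    define A0 where "A0 = {a \<in> W0. bad a \<chi>}"
    have links: "{t \<in> box Ws. a # t \<in> {t. far_clique q \<chi> t}}
      = {t \<in> {t. far_clique q \<chi> t} \<inter> box Ws. map (\<lambda>b. \<chi> (a, b)) t \<in> far_lists q d ?k}" if a: "a \<in> W0" for a
    proof -
      have "map (\<lambda>b. \<chi> (a, b)) t \<in> far_lists q d ?k \<longleftrightarrow> sorted_wrt (far q) (map (\<lambda>b. \<chi> (a, b)) t)"
        if t: "t \<in> box Ws" for t
      proof -
        have "\<chi> (a, b) \<in> words q d" if "b \<in> set t" for b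
        proof -
          have "b \<in> U" using set_box[OF t] that unfolding U_def by auto
          then have "(a, b) \<in> pairs N" using below[OF a] UN unfolding pairs_def by auto
          then show ?thesis using \<chi> by (auto simp: PiE_iff)
        qed
        moreover have "length t = ?k" using t unfolding box_def by (auto dest: list_all2_lengthD)
        ultimately show ?thesis unfolding far_lists_def by auto
      qed
      then show ?thesis by auto
    qed
    have "m div 2 \<le> card A0"
    proof (rule ccontr)
      assume "\<not> m div 2 \<le> card A0"
      then have "m \<le> 2 * card (W0 - A0)"
        using finW0 by (subst card_Diff_subset) (auto simp: A0_def)
      then have "real m * ?\<theta> \<le> 2 * card (W0 - A0) * ?\<theta>"
        using \<kappa>(1) \<tau>'(1) by (intro mult_right_mono) auto
      also have "\<dots> = 2 * (\<Sum>a\<in>W0 - A0. ?\<theta>)" by simp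
      also have "\<dots> \<le> 2 * (\<Sum>a\<in>W0 - A0. real (card {t \<in> box Ws. a # t \<in> {t. far_clique q \<chi> t}}))"
      proof (intro mult_left_mono sum_mono)
        fix a assume "a \<in> W0 - A0"
        then show "?\<theta> \<le> real (card {t \<in> box Ws. a # t \<in> {t. far_clique q \<chi> t}})"
          unfolding A0_def bad_def by (subst links) auto
      qed simp
      also have "\<dots> \<le> 2 * (\<Sum>a\<in>W0. real (card {t \<in> box Ws. a # t \<in> {t. far_clique q \<chi> t}}))"
        using finW0(1) by (intro mult_left_mono sum_mono2) auto
      also have "\<dots> = 2 * real (card ({t. far_clique q \<chi> t} \<inter> box (W0 # Ws)))"
        using card_links[OF finW0(1) finWs, where T = "{t. far_clique q \<chi> t}"] by simp
      finally show False using \<chi> by (simp add: mult_ac)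
    qed
    then obtain A where "A \<subseteq> A0" "card A = m div 2"
      by (metis obtain_subset_with_card_n)
    then show "\<chi> \<in> (\<Union>A\<in>?S. ?G A)"
      using \<chi> unfolding A0_def by (intro UN_I[of A]) auto
  qed
  then have "card ?E \<le> card (\<Union>A\<in>?S. ?G A)"
    using fin\<Omega> finW0(1) by (intro card_mono) auto
  also have "\<dots> \<le> (\<Sum>A\<in>?S. card (?G A))"
    using finW0(1) by (intro card_UN_le) auto
  finally have "card ?E * (b ^ (m div 4)) ^ (m div 2) \<le> (\<Sum>A\<in>?S. card (?G A)) * (b ^ (m div 4)) ^ (m div 2)"
    by (rule mult_le_mono1)
  also have "\<dots> = (\<Sum>A\<in>?S. card (?G A) * (b ^ (m div 4)) ^ (m div 2))"
    by (rule sum_distrib_right)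
  also have "\<dots> \<le> (\<Sum>A\<in>?S. ?F ^ (m div 2) * card ?\<Omega>)"
  proof (rule sum_mono)
    fix A assume "A \<in> ?S"
    then show "card (?G A) * (b ^ (m div 4)) ^ (m div 2) \<le> ?F ^ (m div 2) * card ?\<Omega>"
      using one[of A] by auto
  qed
  also have "\<dots> = card ?S * (?F ^ (m div 2) * card ?\<Omega>)" by simp
  also have "\<dots> \<le> 2 ^ m * (?F ^ (m div 2) * card ?\<Omega>)"
  proof (rule mult_le_mono1)
    have "card ?S \<le> card (Pow W0)" using finW0(1) by (intro card_mono) auto
    then show "card ?S \<le> 2 ^ m" using finW0 by (simp add: card_Pow)
  qed
  finally show ?thesis by (simp only: mult.assoc)
qed

text \<open>
Boxes with \<open>k\<close> parts will be shown to contain at least an \<open>r^(-loss k)\<close> proportion of cliques.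
\<close>

primrec loss :: "nat \<Rightarrow> nat" where
  "loss 0 = 0"
| "loss (Suc k) = k * (loss k + 3 * k + 4) + 1"

lemma power_le_two_power:
  fixes m X :: nat
  assumes "16 * X\<^sup>2 \<le> m"
  shows "(m + 1) ^ X \<le> 2 ^ m"
proof -
  have "(4 * X)\<^sup>2 \<le> m" using assms by (simp add: power_mult_distrib)
  then have "real ((4 * X)\<^sup>2) \<le> real m" by (simp only: of_nat_le_iff)
  then have X: "4 * real X \<le> sqrt m"
    by (intro real_le_rsqrt) simp
  have "ln (real m + 1) = 2 * ln (sqrt (real m + 1))"
    by (simp add: ln_sqrt)
  also have "\<dots> \<le> 2 * (sqrt (real m + 1) - 1)"
    by (intro mult_left_mono ln_le_minus_one) auto
  also have "sqrt (real m + 1) - 1 \<le> sqrt m"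
    using sqrt_add_le_add_sqrt[of "real m" 1] by simp
  finally have "ln (real m + 1) \<le> 2 * sqrt m" by simp
  then have "4 * real X * ln (real m + 1) \<le> sqrt m * (2 * sqrt m)"
    using X by (intro mult_mono) auto
  then have "real X * ln (real m + 1) \<le> real m * (1 / 2)" by simp
  also have "\<dots> \<le> real m * ln 2"
    using ln_le_minus_one[of "1 / 2 :: real"] by (intro mult_left_mono) (simp_all add: ln_div)
  finally have "exp (real X * ln (real m + 1)) \<le> exp (real m * ln 2)" by simp
  then have "(real m + 1) ^ X \<le> 2 ^ m" by (simp add: exp_of_nat_mult)
  then have "real ((m + 1) ^ X) \<le> real (2 ^ m)" by (simp add: add.commute)
  then show ?thesis by (simp only: of_nat_le_iff)
qed

text \<open>
The left hand side bounds the number of boxes with \<open>k + 1\<close> parts of size \<open>m\<close> times the loss in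
\<open>card_rich_poor\<close>, and the right hand side is the gain there; the factor \<open>q + 2\<close> leaves room for the
sum over all \<open>k \<le> q\<close>. All terms are compared with powers of
\<open>b\<close> whose exponents are multiples of \<open>m^2\<close>. The number \<open>N = b^g\<close> of vertices is the largest for which
this works, up to a constant in the exponent.
\<close>

lemma union_bound_numbers:
  fixes q b g k m r L :: nat
  assumes k: "k \<le> q" and q: "2 \<le> q" "q \<le> r" and b: "2 ^ 32 \<le> b"
    and g: "r ^ (2 * (loss k + 3 * k + 2)) \<le> g"
    and m: "m = 2 ^ Suc k * (64 * (q + 1) * g)" and L: "L = r ^ (loss k + 2 * k + 1)"
  shows "(q + 2) * ((b ^ g) ^ m) ^ Suc k
      * (2 ^ m * (((m + 1) ^ (k * L)) ^ (r ^ k) * k * 2 ^ m) ^ (m div 2)) \<le> (b ^ (m div 4)) ^ (m div 2)"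
proof -
  \<comment> \<open>The factor \<open>64\<close> in \<open>m\<close> makes the divisions by \<open>2\<close> and \<open>4\<close> exact and leaves enough room in the
    exponents below.\<close>
  define u where "u = 2 ^ Suc k * (8 * (q + 1) * g)"
  have mu: "m = 8 * u" unfolding m u_def by simp
  have md: "m div 4 = 2 * u" "m div 2 = 4 * u" unfolding mu by auto
  have "0 < r ^ (2 * (loss k + 3 * k + 2))" using q by simp
  then have g0: "0 < g" using g by linarith
  have u0: "0 < u" using g0 unfolding u_def by simp
  have ule: "u \<le> u\<^sup>2" using u0 by (simp add: power2_eq_square)
  have gm: "64 * (q + 1) * g \<le> m" unfolding m by simp
  have "64 * g \<le> m" using gm by (simp add: algebra_simps)
  have km: "k \<le> m" "q + 2 \<le> m"
    using gm g0 k mult_le_mono[of 1 g "64 * (q + 1)" "64 * (q + 1)"] by (auto simp: algebra_simps)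
  have "k * L * r ^ k \<le> r * L * r ^ k" using k q by (intro mult_le_mono) auto
  also have "\<dots> = r ^ (1 + (loss k + 2 * k + 1) + k)" unfolding L by (simp only: power_add power_one_right)
  also have "1 + (loss k + 2 * k + 1) + k = loss k + 3 * k + 2" by simp
  finally have X: "k * L * r ^ k \<le> r ^ (loss k + 3 * k + 2)" .
  have "16 * (k * L * r ^ k)\<^sup>2 \<le> 16 * (r ^ (loss k + 3 * k + 2))\<^sup>2"
    using X by (intro mult_le_mono2 power_mono) auto
  also have "\<dots> = 16 * r ^ (2 * (loss k + 3 * k + 2))" by (simp only: power_mult[symmetric] mult.commute)
  also have "\<dots> \<le> m" using g \<open>64 * g \<le> m\<close> by linarith
  finally have "(m + 1) ^ (k * L * r ^ k) \<le> 2 ^ m" by (rule power_le_two_power)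
  then have F1: "((m + 1) ^ (k * L)) ^ (r ^ k) \<le> 2 ^ m" by (simp only: power_mult[symmetric])
  have two: "x \<le> 2 ^ m" if "x \<le> m" for x :: nat
    using that less_exp[of m] by linarith
  have "((m + 1) ^ (k * L)) ^ (r ^ k) * k * 2 ^ m \<le> 2 ^ m * 2 ^ m * 2 ^ m"
    by (intro mult_le_mono F1 two km order.refl)
  also have "\<dots> = 2 ^ (24 * u)" unfolding mu by (simp flip: power_add)
  finally have F: "(((m + 1) ^ (k * L)) ^ (r ^ k) * k * 2 ^ m) ^ (m div 2) \<le> (2 ^ (24 * u)) ^ (4 * u)"
    unfolding md by (rule power_mono) simp
  have "64 * (g * m * Suc k) = m * (64 * g * Suc k)" by (simp only: mult_ac)
  also have "\<dots> \<le> m * m"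
    using gm k by (intro mult_le_mono2 order.trans[OF _ gm]) (simp add: algebra_simps)
  also have "\<dots> = 64 * u\<^sup>2" unfolding mu by (simp add: power2_eq_square)
  finally have e: "g * m * Suc k \<le> u\<^sup>2" by simp
  have "((b ^ g) ^ m) ^ Suc k = b ^ (g * m * Suc k)" by (simp only: power_mult[symmetric])
  also have "\<dots> \<le> b ^ u\<^sup>2" using e b by (intro power_increasing) auto
  finally have N: "((b ^ g) ^ m) ^ Suc k \<le> b ^ u\<^sup>2" .
  have "(q + 2) * ((b ^ g) ^ m) ^ Suc k
      * (2 ^ m * (((m + 1) ^ (k * L)) ^ (r ^ k) * k * 2 ^ m) ^ (m div 2))
    \<le> 2 ^ m * b ^ u\<^sup>2 * (2 ^ m * (2 ^ (24 * u)) ^ (4 * u))"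
    by (intro mult_le_mono N F two km order.refl)
  also have "\<dots> = b ^ u\<^sup>2 * 2 ^ (16 * u + 96 * u\<^sup>2)"
    unfolding mu by (simp add: power_add power_mult[symmetric] power2_eq_square mult_ac)
      (simp flip: power_add)
  also have "\<dots> \<le> b ^ u\<^sup>2 * 2 ^ (32 * (4 * u\<^sup>2))"
    using ule by (intro mult_le_mono2 power_increasing) auto
  also have "\<dots> = b ^ u\<^sup>2 * (2 ^ 32) ^ (4 * u\<^sup>2)" by (simp only: power_mult)
  also have "\<dots> \<le> b ^ u\<^sup>2 * b ^ (4 * u\<^sup>2)"
    using b by (intro mult_le_mono2 power_mono) auto
  also have "\<dots> = b ^ (5 * u\<^sup>2)" by (simp flip: power_add)
  also have "\<dots> \<le> b ^ (8 * u\<^sup>2)" using b by (intro power_increasing) auto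
  also have "\<dots> = (b ^ (m div 4)) ^ (m div 2)"
    unfolding md by (simp add: power_mult[symmetric] power2_eq_square)
  finally show ?thesis .
qed

text \<open>
The parts double with every step because richness concerns halves of the parts.
\<close>

definition many_cliques :: "nat \<Rightarrow> nat \<Rightarrow> nat \<Rightarrow> nat \<Rightarrow> (nat \<times> nat \<Rightarrow> nat list) \<Rightarrow> nat \<Rightarrow> bool" where
  "many_cliques q r n N \<chi> k \<longleftrightarrow> (\<forall>Ws. length Ws = k \<longrightarrow> increasing Ws \<longrightarrow>
     (\<forall>W \<in> set Ws. W \<subseteq> {..<N} \<and> card W = 2 ^ k * n) \<longrightarrow>
     (2 ^ k * n) ^ k \<le> r ^ loss k * card ({t. far_clique q \<chi> t} \<inter> box Ws))"

lemma increasing_mono: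
  assumes "increasing Ws" "list_all2 (\<subseteq>) Zs Ws"
  shows "increasing Zs"
  unfolding increasing_def sorted_wrt_iff_nth_less
proof (intro allI impI ballI)
  fix i j a b
  assume ij: "i < j" "j < length Zs" and ab: "a \<in> Zs ! i" "b \<in> Zs ! j"
  have "length Zs = length Ws" "Zs ! i \<subseteq> Ws ! i" "Zs ! j \<subseteq> Ws ! j"
    using assms(2) ij by (auto simp: list_all2_conv_all_nth)
  then show "a < b"
    using assms(1) ij ab unfolding increasing_def sorted_wrt_iff_nth_less by (metis subsetD)
qed

lemma many_cliques_rich:
  assumes "many_cliques q r n N \<chi> k" and r: "0 < r"
    and len: "length Ws = k" and inc: "increasing Ws"
    and Ws: "\<forall>W \<in> set Ws. W \<subseteq> {..<N} \<and> card W = 2 ^ Suc k * n"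
  shows "rich q (1 / (2 ^ k * real r ^ loss k)) (2 ^ Suc k * n) Ws \<chi>"
  unfolding rich_def
proof (intro allI impI)
  fix Zs assume Zs: "list_all2 (\<subseteq>) Zs Ws" "\<forall>Z \<in> set Zs. 2 ^ Suc k * n \<le> 2 * card Z"
  have lenZ: "length Zs = k" using Zs(1) len by (auto dest: list_all2_lengthD)
  have ex: "\<exists>Y. Y \<subseteq> Z \<and> card Y = 2 ^ k * n" if "Z \<in> set Zs" for Z
  proof -
    have "2 ^ k * n \<le> card Z" using Zs(2) that by auto
    then show ?thesis by (rule obtain_subset_with_card_n) blast
  qed
  define Y where "Y Z = (SOME Y. Y \<subseteq> Z \<and> card Y = 2 ^ k * n)" for Z :: "nat set"
  have Y: "Y Z \<subseteq> Z \<and> card (Y Z) = 2 ^ k * n" if "Z \<in> set Zs" for Z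
    unfolding Y_def by (rule someI_ex[OF ex[OF that]])
  let ?Ys = "map Y Zs"
  have YZ: "list_all2 (\<subseteq>) ?Ys Zs" using Y by (auto simp: list_all2_conv_all_nth)
  have ZW: "Z \<subseteq> {..<N}" if Zin: "Z \<in> set Zs" for Z
  proof -
    obtain i where i: "i < length Zs" "Z = Zs ! i"
      using Zin by (metis in_set_conv_nth)
    then have "Z \<subseteq> Ws ! i" "Ws ! i \<in> set Ws"
      using list_all2_nthD[OF Zs(1) i(1)] lenZ len by auto
    then show ?thesis using Ws by blast
  qed
  have "(2 ^ k * n) ^ k \<le> r ^ loss k * card ({t. far_clique q \<chi> t} \<inter> box ?Ys)"
  proof (rule assms(1)[unfolded many_cliques_def, rule_format])
    show "length ?Ys = k" using lenZ by simp
    show "increasing ?Ys" by (rule increasing_mono[OF increasing_mono[OF inc Zs(1)] YZ])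
    fix W assume "W \<in> set ?Ys"
    then show "W \<subseteq> {..<N} \<and> card W = 2 ^ k * n" using Y ZW by fastforce
  qed
  also have "\<dots> \<le> r ^ loss k * card ({t. far_clique q \<chi> t} \<inter> box Zs)"
  proof (intro mult_le_mono2 card_mono)
    have "finite Z" if "Z \<in> set Zs" for Z using ZW[OF that] finite_subset by blast
    then show "finite ({t. far_clique q \<chi> t} \<inter> box Zs)" using finite_box[of Zs] by auto
    show "{t. far_clique q \<chi> t} \<inter> box ?Ys \<subseteq> {t. far_clique q \<chi> t} \<inter> box Zs"
      using box_mono[OF YZ] by auto
  qed
  finally have "real ((2 ^ k * n) ^ k) \<le> real (r ^ loss k * card ({t. far_clique q \<chi> t} \<inter> box Zs))"
    by (simp only: of_nat_le_iff)
  moreover have "real ((2 ^ Suc k * n) ^ k) = 2 ^ k * real ((2 ^ k * n) ^ k)"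
    by (simp add: power_mult_distrib)
  ultimately show "1 / (2 ^ k * real r ^ loss k) * real (2 ^ Suc k * n) ^ length Ws
      \<le> real (card ({t. far_clique q \<chi> t} \<inter> box Zs))"
    using r unfolding len by (simp add: divide_simps mult_ac)
qed

text \<open>
If a box violates the induction step, then its tail is rich while the box itself is poor. Such
failures are excluded for all boxes at once by the union bound.
\<close>

lemma exists_colouring:
  fixes q h D :: nat
  defines "r \<equiv> q ^ (h * D)" and "b \<equiv> q ^ D"
  defines "g \<equiv> r ^ (\<Sum>k\<le>q. 2 * (loss k + 3 * k + 2))"
  defines "n \<equiv> 64 * (q + 1) * g" and "N \<equiv> b ^ g"
  assumes q: "2 \<le> q" and h: "0 < h" and D: "0 < D" and b: "2 ^ 32 \<le> b"
    and hit: "\<And>Ys. length Ys \<le> q \<Longrightarrow>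
      (\<forall>Y \<in> set Ys. Y \<subseteq> words q (h * D) \<and> q ^ (h * D) \<le> q ^ D * card Y) \<Longrightarrow>
      far_lists q (h * D) (length Ys) \<inter> box Ys \<noteq> {}"
  obtains \<chi> where "\<chi> \<in> pairs N \<rightarrow>\<^sub>E words q (h * D)" "many_cliques q r n N \<chi> (q + 1)"
proof -
  let ?\<Omega> = "pairs N \<rightarrow>\<^sub>E words q (h * D)"
  let ?K = "\<lambda>\<chi>. {t. far_clique q \<chi> t}"
  define m where "m k = 2 ^ Suc k * n" for k
  \<comment> \<open>Here \<open>\<tau>\<close> is the density given by the induction hypothesis, \<open>\<tau>'\<close> is so small that \<open>r^k\<close>
    containers of density \<open>k \<tau>'\<close> cannot cover a box of density \<open>\<tau>\<close>, and \<open>\<kappa>\<close> is so small that the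
    vertices outside their containers make up at most an eighth of a part.\<close>
  define \<tau> where "\<tau> k = 1 / (2 ^ k * real r ^ loss k)" for k
  define \<tau>' where "\<tau>' k = 1 / real r ^ (loss k + 2 * k + 1)" for k
  define \<kappa> where "\<kappa> k = 1 / real r ^ (k + 3)" for k
  define poor where "poor V \<chi> \<longleftrightarrow> rich q (\<tau> (length (tl V))) (m (length (tl V))) (tl V) \<chi> \<and>
      2 * card (?K \<chi> \<inter> box V)
        < (\<kappa> (length (tl V)) * \<tau>' (length (tl V))) ^ length (tl V) * real (m (length (tl V))) ^ length V" for V \<chi>
  define boxes where "boxes k = {V. set V \<subseteq> {W. W \<subseteq> {..<N} \<and> card W = m k} \<and> length V = Suc k}" for k
  define fail where "fail k = (\<Union>V\<in>{V \<in> boxes k. increasing V}. {\<chi> \<in> ?\<Omega>. poor V \<chi>})" for k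
  have qb: "q \<le> b" unfolding b_def using D q by (metis One_nat_def Suc_leI power_increasing power_one_right
        le_trans one_le_numeral)
  have br: "b \<le> r" unfolding b_def r_def using h q by (intro power_increasing) auto
  have r2: "2 < r" using br b by simp
  have qr: "q \<le> r" using qb br by simp
  have g0: "0 < g" unfolding g_def using r2 by simp
  have m0: "0 < m k" for k unfolding m_def n_def using g0 by simp
  have fin\<Omega>: "finite ?\<Omega>" by (intro finite_PiE) auto
  have card\<Omega>: "0 < card ?\<Omega>"
    using q by (simp add: card_PiE)
  have rb: "r = b * q ^ (h * D - D)"
  proof -
    have "D + (h * D - D) = h * D" using h by (cases h) auto
    then show ?thesis unfolding r_def b_def by (metis power_add)
  qed
  have fail_bound: "(q + 2) * card (fail k) \<le> card ?\<Omega>" if k: "k \<le> q" for k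
  proof -
    define L where "L = r ^ (loss k + 2 * k + 1)"
    define F where "F = ((m k + 1) ^ (k * L)) ^ (r ^ k) * k * 2 ^ m k"
    let ?Y = "(b ^ (m k div 4)) ^ (m k div 2)"
    have finB: "finite (boxes k)" and cardB: "card (boxes k) \<le> (N ^ m k) ^ Suc k"
    proof -
      have "finite {W. W \<subseteq> {..<N} \<and> card W = m k}" by simp
      then show "finite (boxes k)" unfolding boxes_def by (rule finite_lists_length_eq)
      have "card {W. W \<subseteq> {..<N} \<and> card W = m k} = N choose m k" by (simp add: n_subsets)
      also have "\<dots> \<le> N ^ m k"
        by (cases "m k \<le> N") (auto intro: binomial_le_pow simp: binomial_eq_0)
      finally show "card (boxes k) \<le> (N ^ m k) ^ Suc k"
        unfolding boxes_def by (subst card_lists_length_eq) (auto intro!: power_mono simp del: power_Suc)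
    qed
    have each: "card {\<chi> \<in> ?\<Omega>. poor V \<chi>} * ?Y \<le> 2 ^ m k * F ^ (m k div 2) * card ?\<Omega>"
      if V: "V \<in> boxes k" "increasing V" for V
    proof -
      obtain W0 Ws where VW: "V = W0 # Ws" and len: "length Ws = k"
        using V(1) unfolding boxes_def by (cases V) auto
      show ?thesis
        unfolding poor_def VW list.sel len F_def r_def
      proof (rule card_rich_poor[where Ws = Ws and y = "q ^ (h * D - D)", unfolded len])
        show "q ^ (h * D) = b * q ^ (h * D - D)" using rb unfolding r_def .
        show "far_lists q (h * D) k \<inter> box Ys \<noteq> {}"
          if Ys: "length Ys = k" "\<And>Y. Y \<in> set Ys \<Longrightarrow> Y \<subseteq> words q (h * D) \<and> q ^ (h * D - D) \<le> card Y" for Ys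
        proof -
          have "q ^ (h * D) \<le> q ^ D * card Y" if "Y \<in> set Ys" for Y
            using rb Ys(2)[OF that] unfolding r_def b_def by simp
          then show ?thesis using hit[of Ys] Ys k by auto
        qed
        show "W \<subseteq> {..<N} \<and> card W = m k" if "W \<in> set (W0 # Ws)" for W
          using V(1) that unfolding VW boxes_def by auto
        show "increasing (W0 # Ws)" using V(2) unfolding VW .
        show "real ((q ^ (h * D)) ^ k) * real k * \<tau>' k < \<tau> k"
        proof -
          have "k * 2 ^ k < r * r ^ k"
          proof (cases "k = 0")
            case False
            have "k * 2 ^ k \<le> r * 2 ^ k" using k qr by simp
            also have "\<dots> < r * r ^ k" using r2 False by (intro mult_strict_left_mono power_strict_mono) auto
            finally show ?thesis .
          qed (use r2 in simp)
          then have "real k * 2 ^ k < real r * real r ^ k"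
            by (metis of_nat_less_iff of_nat_mult of_nat_numeral of_nat_power)
          then have "real r ^ k * real k * (2 ^ k * real r ^ loss k) < real r ^ (loss k + 2 * k + 1)"
            using r2 by (simp add: power_add power_mult power2_eq_square mult_2 mult_ac)
          then show ?thesis
            using r2 unfolding \<tau>_def \<tau>'_def r_def[symmetric] by (simp add: divide_simps)
        qed
        show "8 * real ((q ^ (h * D)) ^ k) * \<kappa> k \<le> 1"
        proof -
          have "(2::real) ^ 3 \<le> real r ^ 3" using r2 by (intro power_mono) auto
          then show ?thesis using r2 unfolding \<kappa>_def r_def[symmetric] by (simp add: power_add divide_simps)
        qed
        show "1 \<le> real L * \<tau>' k" using r2 unfolding L_def \<tau>'_def by simp
      qed (use q b m0 r2 in \<open>auto simp: \<tau>'_def \<kappa>_def\<close>)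
    qed
    have "card (fail k) \<le> (\<Sum>V\<in>{V \<in> boxes k. increasing V}. card {\<chi> \<in> ?\<Omega>. poor V \<chi>})"
      unfolding fail_def using finB by (intro card_UN_le) auto
    then have "card (fail k) * ?Y \<le> (\<Sum>V\<in>{V \<in> boxes k. increasing V}. card {\<chi> \<in> ?\<Omega>. poor V \<chi>}) * ?Y"
      by (rule mult_le_mono1)
    also have "\<dots> = (\<Sum>V\<in>{V \<in> boxes k. increasing V}. card {\<chi> \<in> ?\<Omega>. poor V \<chi>} * ?Y)"
      by (rule sum_distrib_right)
    also have "\<dots> \<le> (\<Sum>V\<in>{V \<in> boxes k. increasing V}. 2 ^ m k * F ^ (m k div 2) * card ?\<Omega>)"
      using each by (intro sum_mono) auto
    also have "\<dots> = card {V \<in> boxes k. increasing V} * (2 ^ m k * F ^ (m k div 2) * card ?\<Omega>)" by simp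
    also have "\<dots> \<le> (N ^ m k) ^ Suc k * (2 ^ m k * F ^ (m k div 2) * card ?\<Omega>)"
      using finB by (intro mult_le_mono1 order.trans[OF card_mono cardB]) auto
    finally have "(q + 2) * (card (fail k) * ?Y) \<le> (q + 2) * ((N ^ m k) ^ Suc k * (2 ^ m k * F ^ (m k div 2) * card ?\<Omega>))"
      by (rule mult_le_mono2)
    also have "\<dots> = ((q + 2) * (N ^ m k) ^ Suc k * (2 ^ m k * F ^ (m k div 2))) * card ?\<Omega>"
      by (simp only: mult_ac)
    also have "\<dots> \<le> ?Y * card ?\<Omega>"
      unfolding N_def F_def
    proof (intro mult_le_mono1 union_bound_numbers[OF k q qr b _ _ L_def])
      have "2 * (loss k + 3 * k + 2) \<le> (\<Sum>k\<le>q. 2 * (loss k + 3 * k + 2))"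
        using k by (intro member_le_sum) auto
      then show "r ^ (2 * (loss k + 3 * k + 2)) \<le> g"
        unfolding g_def using r2 by (intro power_increasing) auto
      show "m k = 2 ^ Suc k * (64 * (q + 1) * g)" unfolding m_def n_def ..
    qed
    finally have "((q + 2) * card (fail k)) * ?Y \<le> card ?\<Omega> * ?Y" by (simp only: mult_ac)
    moreover have "0 < ?Y" using b by simp
    ultimately show ?thesis by (simp only: mult_le_cancel2)
  qed
  have "(q + 2) * card (\<Union>k\<le>q. fail k) \<le> (q + 2) * (\<Sum>k\<le>q. card (fail k))"
    by (intro mult_le_mono2 card_UN_le) simp
  also have "\<dots> = (\<Sum>k\<le>q. (q + 2) * card (fail k))" by (rule sum_distrib_left)
  also have "\<dots> \<le> (\<Sum>k\<le>q. card ?\<Omega>)" using fail_bound by (intro sum_mono) auto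
  also have "\<dots> < (q + 2) * card ?\<Omega>" using card\<Omega> by simp
  finally have "card (\<Union>k\<le>q. fail k) < card ?\<Omega>" by (simp only: mult_less_cancel1)
  moreover have "(\<Union>k\<le>q. fail k) \<subseteq> ?\<Omega>" unfolding fail_def by auto
  ultimately have "\<not> ?\<Omega> \<subseteq> (\<Union>k\<le>q. fail k)" by (metis less_irrefl subset_antisym)
  then obtain \<chi> where \<chi>: "\<chi> \<in> ?\<Omega>" "\<And>k. k \<le> q \<Longrightarrow> \<chi> \<notin> fail k" by auto
  have "many_cliques q r n N \<chi> k" if "k \<le> q + 1" for k
    using that
  proof (induction k)
    case 0
    have "{t. far_clique q \<chi> t} \<inter> {[]} = {[]}" by auto
    then show ?case unfolding many_cliques_def by simp
  next
    case (Suc k)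
    show ?case
      unfolding many_cliques_def
    proof (intro allI impI)
      fix V assume V: "length V = Suc k" "increasing V"
        "\<forall>W \<in> set V. W \<subseteq> {..<N} \<and> card W = 2 ^ Suc k * n"
      obtain W0 Ws where VW: "V = W0 # Ws" and len: "length Ws = k" using V(1) by (cases V) auto
      have "rich q (\<tau> k) (m k) Ws \<chi>"
        unfolding \<tau>_def m_def using Suc V(2,3) r2 len
        by (intro many_cliques_rich) (auto simp: VW increasing_def)
      moreover have "V \<in> boxes k" using V unfolding boxes_def m_def by auto
      then have "\<not> poor V \<chi>" using \<chi>(1) \<chi>(2)[of k] Suc.prems V(2) unfolding fail_def by auto
      ultimately have "(\<kappa> k * \<tau>' k) ^ k * real (m k) ^ Suc k \<le> 2 * real (card (?K \<chi> \<inter> box V))"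
        unfolding poor_def VW using len by simp
      moreover have "(\<kappa> k * \<tau>' k) ^ k = 1 / real r ^ (k * (loss k + 3 * k + 4))"
      proof -
        have "\<kappa> k * \<tau>' k = 1 / real r ^ (loss k + 3 * k + 4)"
        proof -
          have "\<kappa> k * \<tau>' k = 1 / (real r ^ (k + 3) * real r ^ (loss k + 2 * k + 1))"
            unfolding \<kappa>_def \<tau>'_def by simp
          also have "real r ^ (k + 3) * real r ^ (loss k + 2 * k + 1) = real r ^ (k + 3 + (loss k + 2 * k + 1))"
            by (simp only: power_add)
          also have "k + 3 + (loss k + 2 * k + 1) = loss k + 3 * k + 4" by simp
          finally show ?thesis .
        qed
        then show ?thesis by (simp add: power_one_over power_mult[symmetric] mult.commute)
      qed
      ultimately have "1 / real r ^ (k * (loss k + 3 * k + 4)) * real (m k) ^ Suc k \<le> 2 * real (card (?K \<chi> \<inter> box V))"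
        by (simp only:)
      moreover have "M \<le> c * Y" if "1 / c * M \<le> Y" "0 < c" for c M Y :: real
        using that by (simp add: pos_divide_le_eq mult.commute)
      ultimately have "real (m k) ^ Suc k \<le> real r ^ (k * (loss k + 3 * k + 4)) * (2 * real (card (?K \<chi> \<inter> box V)))"
        using r2 by simp
      also have "\<dots> \<le> real r ^ (k * (loss k + 3 * k + 4)) * (real r * real (card (?K \<chi> \<inter> box V)))"
        using r2 by (intro mult_left_mono mult_right_mono) auto
      also have "\<dots> = real r ^ loss (Suc k) * real (card (?K \<chi> \<inter> box V))" by simp
      finally have "real (m k ^ Suc k) \<le> real (r ^ loss (Suc k) * card (?K \<chi> \<inter> box V))" by simp
      then show "(2 ^ Suc k * n) ^ Suc k \<le> r ^ loss (Suc k) * card (?K \<chi> \<inter> box V)"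
        unfolding m_def by (simp only: of_nat_le_iff)
    qed
  qed
  then show thesis using that \<chi>(1) by blast
qed

section \<open>Three-uniform graphs with small clique-free sets\<close>

definition far_triples :: "nat \<Rightarrow> nat \<Rightarrow> (nat \<times> nat \<Rightarrow> nat list) \<Rightarrow> nat set set" where
  "far_triples q N \<chi> = {{a, b, c} | a b c. a < b \<and> b < c \<and> c < N \<and> far q (\<chi> (a, b)) (\<chi> (a, c))}"

lemma ordered_triple_eq:
  fixes a b c :: nat
  assumes "{a, b, c} = {a', b', c'}" "a < b" "b < c" "a' < b'" "b' < c'"
  shows "a = a' \<and> b = b' \<and> c = c'"
proof -
  have l: "sorted_list_of_set {a, b, c} = [a, b, c]"
    by (rule sorted_list_of_set_unique[THEN iffD1]) (use assms(2,3) in auto)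
  have l': "sorted_list_of_set {a', b', c'} = [a', b', c']"
    by (rule sorted_list_of_set_unique[THEN iffD1]) (use assms(4,5) in auto)
  have "[a, b, c] = [a', b', c']"
    by (rule trans[OF l[symmetric] trans[OF arg_cong[where f = sorted_list_of_set, OF assms(1)] l']])
  then show ?thesis by simp
qed

lemma far_triples_iff:
  assumes "a < b" "b < c"
  shows "{a, b, c} \<in> far_triples q N \<chi> \<longleftrightarrow> c < N \<and> far q (\<chi> (a, b)) (\<chi> (a, c))"
  using ordered_triple_eq[of a b c] assms unfolding far_triples_def by fastforce

text \<open>
The colours of the pairs that contain the least vertex of a \<open>(q + 2)\<close>-clique would be \<open>q + 1\<close> pairwise far
words.
\<close>

lemma far_triples_clique_free:
  assumes q: "0 < q" and \<chi>: "\<chi> \<in> pairs N \<rightarrow>\<^sub>E words q d"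
  shows "clique_free 3 (q + 2) V (far_triples q N \<chi>)"
  unfolding clique_free_def
proof
  assume "\<exists>T \<in> nsets V (q + 2). nsets T 3 \<subseteq> far_triples q N \<chi>"
  then obtain T where T: "finite T" "card T = q + 2" "nsets T 3 \<subseteq> far_triples q N \<chi>"
    unfolding nsets_def by auto
  define xs where "xs = sorted_list_of_set T"
  have xs: "set xs = T" "length xs = q + 2" "sorted_wrt (<) xs"
    using T(1,2) unfolding xs_def by (auto simp: strict_sorted_list_of_set)
  have lt: "xs ! i < xs ! j" if "i < j" "j < q + 2" for i j
    using xs(2,3) that by (simp add: sorted_wrt_iff_nth_less)
  have tri: "xs ! j < N \<and> far q (\<chi> (xs ! 0, xs ! i)) (\<chi> (xs ! 0, xs ! j))"
    if "0 < i" "i < j" "j < q + 2" for i j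
  proof -
    have "{xs ! 0, xs ! i, xs ! j} \<in> nsets T 3"
      using lt[of 0 i] lt[of i j] that xs(1,2) unfolding nsets_def by (auto intro!: nth_mem)
    then show ?thesis
      using T(3) far_triples_iff[of "xs ! 0" "xs ! i" "xs ! j"] lt that by auto
  qed
  define ys where "ys = map (\<lambda>i. \<chi> (xs ! 0, xs ! i)) [1..<q + 2]"
  have "sorted_wrt (far q) ys"
    unfolding ys_def using tri by (auto simp: sorted_wrt_iff_nth_less simp del: upt_Suc)
  moreover have "set ys \<subseteq> words q d"
  proof
    fix y assume "y \<in> set ys"
    then obtain i where i: "0 < i" "i < q + 2" "y = \<chi> (xs ! 0, xs ! i)"
      unfolding ys_def by (auto simp: Suc_le_eq simp del: upt_Suc)
    have "xs ! i < N"
    proof (cases "i = q + 1")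
      case True
      then show ?thesis using tri[of 1 i] q by simp
    next
      case False
      then show ?thesis using tri[of i "q + 1"] lt[of i "q + 1"] i by auto
    qed
    then have "(xs ! 0, xs ! i) \<in> pairs N" using lt[of 0 i] i unfolding pairs_def by simp
    then show "y \<in> words q d" using \<chi> i(3) by (auto simp: PiE_iff)
  qed
  moreover have "length ys = q + 1" unfolding ys_def by simp
  ultimately show False using no_far_clique[OF q, of ys d] by simp
qed

lemma far_clique_triples:
  assumes "sorted_wrt (<) t" "set t \<subseteq> {..<N}" "far_clique q \<chi> t"
  shows "nsets (set t) 3 \<subseteq> far_triples q N \<chi>"
proof -
  have far: "far q (\<chi> (a, b)) (\<chi> (a, c))" if "a \<in> set t" "b \<in> set t" "c \<in> set t" "a < b" "b < c" for a b c
    using assms(1,3) that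
  proof (induction t)
    case (Cons x t)
    have "b \<noteq> x" "c \<noteq> x" using Cons.prems by auto
    then have bc: "b \<in> set t" "c \<in> set t" using Cons.prems by auto
    show ?case
    proof (cases "a = x")
      case True
      obtain i j where ij: "i < length t" "b = t ! i" "j < length t" "c = t ! j"
        using bc by (metis in_set_conv_nth)
      have "i < j"
      proof (rule ccontr)
        assume "\<not> i < j"
        moreover have "sorted_wrt (<) t" using Cons.prems(1) by simp
        ultimately have "t ! j \<le> t ! i"
          using sorted_wrt_nth_less[of "(<)" t j i] ij(1) by (cases "j = i") auto
        then show False using Cons.prems(7) ij by simp
      qed
      then show ?thesis
        using Cons.prems(2) True ij by (auto simp: sorted_wrt_iff_nth_less)
    next
      case False
      then show ?thesis using Cons bc by auto
    qed
  qed simp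
  show ?thesis
  proof
    fix e assume "e \<in> nsets (set t) 3"
    then have e: "e \<subseteq> set t" "finite e" "card e = 3" unfolding nsets_def by auto
    define xs where "xs = sorted_list_of_set e"
    have xs: "set xs = e" "length xs = 3" "sorted_wrt (<) xs"
      using e(2,3) unfolding xs_def by (auto simp: strict_sorted_list_of_set)
    then obtain a b c where abc: "xs = [a, b, c]"
      by (auto simp: numeral_3_eq_3 length_Suc_conv)
    then have "e = {a, b, c}" "a < b" "b < c" using xs by auto
    then show "e \<in> far_triples q N \<chi>"
      using far_triples_iff[of a b c] far[of a b c] e(1) assms(2) by auto
  qed
qed

lemma sorted_box:
  assumes "increasing Ws" "t \<in> box Ws"
  shows "sorted_wrt (<) t"
  unfolding sorted_wrt_iff_nth_less
proof (intro allI impI)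
  fix i j assume ij: "i < j" "j < length t"
  then have "length t = length Ws" "t ! i \<in> Ws ! i" "t ! j \<in> Ws ! j"
    using assms(2) unfolding box_def by (auto simp: list_all2_conv_all_nth)
  moreover have "\<forall>a\<in>Ws ! i. \<forall>b\<in>Ws ! j. a < b"
    by (rule sorted_wrt_nth_less[OF assms(1)[unfolded increasing_def] ij(1)])
      (use ij(2) \<open>length t = length Ws\<close> in simp)
  ultimately show "t ! i < t ! j" by blast
qed

lemma exists_increasing_box:
  fixes W :: "nat set"
  assumes "finite W" "card W = k * c"
  shows "\<exists>Ws. length Ws = k \<and> increasing Ws \<and> (\<forall>X \<in> set Ws. X \<subseteq> W \<and> card X = c)"
  using assms
proof (induction k arbitrary: W)
  case 0
  then show ?case by (simp add: increasing_def)
next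
  case (Suc k)
  define xs where "xs = sorted_list_of_set W"
  have xs: "set xs = W" "length xs = Suc k * c" "sorted_wrt (<) xs" "distinct xs"
    using Suc.prems unfolding xs_def by (auto simp: strict_sorted_list_of_set)
  define A where "A = set (take c xs)"
  define B where "B = set (drop c xs)"
  have "card A = c" "card B = k * c"
    unfolding A_def B_def using xs(2,4) by (simp_all add: distinct_card)
  moreover have AB: "a < b" if "a \<in> A" "b \<in> B" for a b
    using that xs(3) sorted_wrt_append[of "(<)" "take c xs" "drop c xs"] unfolding A_def B_def by auto
  have subs: "A \<subseteq> W" "B \<subseteq> W" "finite B"
    unfolding A_def B_def using xs(1) set_take_subset[of c xs] set_drop_subset[of c xs] by auto
  moreover obtain Ws where Ws: "length Ws = k" "increasing Ws" "\<forall>X \<in> set Ws. X \<subseteq> B \<and> card X = c"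
    using Suc.IH[OF subs(3) \<open>card B = k * c\<close>] by blast
  have "increasing (A # Ws)"
    using Ws(2,3) AB unfolding increasing_def by auto
  ultimately show ?case
    using Ws by (intro exI[of _ "A # Ws"]) auto
qed

text \<open>
A \<open>3\<close>-graph on \<open>b^g\<close> vertices without \<open>(q + 2)\<close>-cliques in which \<open>O(g)\<close> vertices always contain a
\<open>(q + 1)\<close>-clique. As \<open>g\<close> is a fixed power of \<open>b\<close>, the number of vertices has the required form \<open>g^(c g)\<close>.
\<close>

lemma three_graph:
  fixes q h D :: nat
  defines "r \<equiv> q ^ (h * D)" and "b \<equiv> q ^ D"
  defines "g \<equiv> r ^ (\<Sum>k\<le>q. 2 * (loss k + 3 * k + 2))"
  assumes q: "2 \<le> q" and h: "0 < h" and D: "0 < D" and b: "2 ^ 32 \<le> b"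
    and hit: "\<And>Ys. length Ys \<le> q \<Longrightarrow>
      (\<forall>Y \<in> set Ys. Y \<subseteq> words q (h * D) \<and> q ^ (h * D) \<le> q ^ D * card Y) \<Longrightarrow>
      far_lists q (h * D) (length Ys) \<inter> box Ys \<noteq> {}"
  shows "\<exists>H. clique_free 3 (q + 2) {..<b ^ g} H \<and>
    (\<forall>W \<subseteq> {..<b ^ g}. card W = (q + 1) * (2 ^ (q + 1) * (64 * (q + 1) * g)) \<longrightarrow>
      (\<exists>S \<in> nsets W (q + 1). nsets S 3 \<subseteq> H))"
proof -
  define n where "n = 64 * (q + 1) * g"
  obtain \<chi> where \<chi>: "\<chi> \<in> pairs (b ^ g) \<rightarrow>\<^sub>E words q (h * D)" "many_cliques q r n (b ^ g) \<chi> (q + 1)"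
    using exists_colouring[OF q h D b[unfolded b_def] hit] unfolding r_def b_def g_def n_def by blast
  let ?H = "far_triples q (b ^ g) \<chi>"
  have "0 < r" unfolding r_def using q by simp
  then have n0: "0 < n" unfolding n_def g_def by simp
  show ?thesis
  proof (intro exI[of _ ?H] conjI allI impI)
    show "clique_free 3 (q + 2) {..<b ^ g} ?H"
      using q \<chi>(1) by (intro far_triples_clique_free) auto
    fix W assume W: "W \<subseteq> {..<b ^ g}" "card W = (q + 1) * (2 ^ (q + 1) * (64 * (q + 1) * g))"
    have finW: "finite W" using W(1) finite_subset by blast
    obtain Ws where Ws: "length Ws = q + 1" "increasing Ws"
      "\<forall>X \<in> set Ws. X \<subseteq> W \<and> card X = 2 ^ (q + 1) * n"
      using exists_increasing_box[OF finW W(2)] unfolding n_def by blast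
    have "(2 ^ (q + 1) * n) ^ (q + 1) \<le> r ^ loss (q + 1) * card ({t. far_clique q \<chi> t} \<inter> box Ws)"
      using \<chi>(2) Ws W(1) unfolding many_cliques_def by blast
    moreover have "0 < (2 ^ (q + 1) * n) ^ (q + 1)" using n0 by simp
    ultimately have "card ({t. far_clique q \<chi> t} \<inter> box Ws) \<noteq> 0" by (metis mult_0_right not_le)
    then obtain t where t: "far_clique q \<chi> t" "t \<in> box Ws"
      by (metis (no_types, lifting) Int_iff card.empty ex_in_conv mem_Collect_eq)
    have st: "sorted_wrt (<) t" using Ws(2) t(2) by (rule sorted_box)
    have tW: "set t \<subseteq> W" using set_box[OF t(2)] Ws(3) by blast
    have "length t = q + 1" using t(2) Ws(1) unfolding box_def by (auto dest: list_all2_lengthD)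
    then have "card (set t) = q + 1" using st by (metis distinct_card strict_sorted_iff)
    then have "set t \<in> nsets W (q + 1)" using tW unfolding nsets_def by simp
    moreover have "nsets (set t) 3 \<subseteq> ?H"
      using st tW W(1) t(1) by (intro far_clique_triples) auto
    ultimately show "\<exists>S \<in> nsets W (q + 1). nsets S 3 \<subseteq> ?H" by blast
  qed
qed

section \<open>The growth of the function\<close>

text \<open>
The upper bound also guarantees that the greatest element in the definition exists, and a single
vertex shows that it is positive.
\<close>

lemma erdos_rogers_bounds:
  fixes V :: "nat set"
  assumes G: "kgraph k V E" "card V = n" "clique_free k t V E"
    and big: "\<And>W. W \<subseteq> V \<Longrightarrow> X \<le> card W \<Longrightarrow> \<not> clique_free k s W (induced_edges E W)"
    and s: "2 \<le> s" and n: "0 < n"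
  shows "erdos_rogers k s t n < X" and "1 \<le> erdos_rogers k s t n"
proof -
  define P where "P m \<longleftrightarrow> (\<forall>(V :: nat set) E.
       kgraph k V E \<and> card V = n \<and> clique_free k t V E \<longrightarrow>
       (\<exists>W \<subseteq> V. card W = m \<and> clique_free k s W (induced_edges E W)))" for m
  have er: "erdos_rogers k s t n = (GREATEST m. P m)"
    unfolding erdos_rogers_def P_def ..
  have bound: "m < X" if "P m" for m
  proof -
    obtain W where "W \<subseteq> V" "card W = m" "clique_free k s W (induced_edges E W)"
      using \<open>P m\<close> G unfolding P_def by blast
    then show ?thesis using big[of W] by (meson not_le)
  qed
  have P1: "P 1"
    unfolding P_def
  proof (intro allI impI)
    fix V' :: "nat set" and E'
    assume "kgraph k V' E' \<and> card V' = n \<and> clique_free k t V' E'"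
    then obtain v where v: "v \<in> V'" using n by (metis card.empty ex_in_conv less_irrefl)
    have "nsets {v} s = {}"
    proof -
      have "card T \<noteq> s" if "T \<subseteq> {v}" for T
        using card_mono[OF _ that] s by simp
      then show ?thesis unfolding nsets_def by auto
    qed
    then show "\<exists>W \<subseteq> V'. card W = 1 \<and> clique_free k s W (induced_edges E' W)"
      using v unfolding clique_free_def by (intro exI[of _ "{v}"]) auto
  qed
  have le: "m \<le> X" if "P m" for m using bound[OF that] by simp
  show "erdos_rogers k s t n < X"
    unfolding er by (rule bound[OF GreatestI_nat[of P, OF P1 le]])
  show "1 \<le> erdos_rogers k s t n"
    unfolding er by (rule Greatest_le_nat[of P, OF P1 le])
qed

lemma four_graph_bound:
  assumes s: "4 \<le> s"
  obtains q G K :: nat where "2 \<le> q" "0 < G" "0 < K"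
    "\<And>D n. 32 \<le> D \<Longrightarrow> 0 < n \<Longrightarrow> n \<le> 2 ^ (q ^ (D * q ^ (G * D)) - 1) \<Longrightarrow>
      erdos_rogers 4 s (s + 1) n < 2 ^ (K * q ^ (G * D)) \<and> 1 \<le> erdos_rogers 4 s (s + 1) n"
proof -
  define q where "q = s - 2"
  have q: "2 \<le> q" "s = q + 2" using s unfolding q_def by auto
  obtain h where h: "0 < h" and hit: "\<forall>D>0. \<forall>Ys. length Ys \<le> q \<longrightarrow>
      (\<forall>Y \<in> set Ys. Y \<subseteq> words q (h * D) \<and> q ^ (h * D) \<le> q ^ D * card Y) \<longrightarrow>
      far_lists q (h * D) (length Ys) \<inter> box Ys \<noteq> {}"
    using far_transversal[OF q(1)] by blast
  define e where "e = (\<Sum>k\<le>q. 2 * (loss k + 3 * k + 2))"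
  have e0: "0 < e" unfolding e_def by (simp add: sum_pos)
  define G where "G = h * e"
  define K where "K = (q + 1) * (2 ^ (q + 1) * (64 * (q + 1)))"
  show thesis
  proof (rule that[of q G K])
    show "2 \<le> q" by (rule q(1))
    show "0 < G" using h e0 unfolding G_def by simp
    show "0 < K" unfolding K_def by simp
    fix D n :: nat
    assume D: "32 \<le> D" and n: "0 < n" "n \<le> 2 ^ (q ^ (D * q ^ (G * D)) - 1)"
    define g where "g = q ^ (G * D)"
    have g: "g = (q ^ (h * D)) ^ e"
      unfolding g_def G_def by (simp add: power_mult[symmetric] mult_ac)
    have "(2::nat) ^ 32 \<le> 2 ^ D" using D by (intro power_increasing) auto
    also have "\<dots> \<le> q ^ D" using q by (intro power_mono) auto
    finally have b: "2 ^ 32 \<le> q ^ D" .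
    have "\<exists>H. clique_free 3 (q + 2) {..<(q ^ D) ^ g} H \<and>
      (\<forall>W \<subseteq> {..<(q ^ D) ^ g}. card W = (q + 1) * (2 ^ (q + 1) * (64 * (q + 1) * g)) \<longrightarrow>
        (\<exists>S \<in> nsets W (q + 1). nsets S 3 \<subseteq> H))"
      unfolding g e_def using D hit by (intro three_graph q h b) auto
    then obtain H where H: "clique_free 3 (q + 2) {..<(q ^ D) ^ g} H"
      "\<And>W. W \<subseteq> {..<(q ^ D) ^ g} \<Longrightarrow> card W = (q + 1) * (2 ^ (q + 1) * (64 * (q + 1) * g)) \<Longrightarrow>
        \<exists>S \<in> nsets W (q + 1). nsets S 3 \<subseteq> H" by blast
    define N where "N = (q ^ D) ^ g - 1"
    have "0 < (q ^ D) ^ g" using q by simp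
    then have N: "{..<(q ^ D) ^ g} = {..N}" unfolding N_def by (metis Suc_diff_1 lessThan_Suc_atMost)
    define V where "V = {..<n}"
    have V: "V \<subseteq> {..<2 ^ N}" "card V = n"
      using n(2) unfolding V_def N_def g_def by (auto simp: power_mult)
    let ?E = "comb_lift V H"
    have gr: "kgraph 4 V ?E" unfolding kgraph_def comb_lift_def V_def by auto
    have free: "clique_free 4 (s + 1) V ?E"
      unfolding q(2) by (rule comb_lift_clique_free[OF H(1)[unfolded N] V(1)])
    have big: "\<not> clique_free 4 s W (induced_edges ?E W)" if W: "W \<subseteq> V" "2 ^ (K * g) \<le> card W" for W
    proof -
      have "\<not> clique_free 4 (q + 1 + 1) W (induced_edges ?E W)"
      proof (rule comb_lift_clique[OF _ W(1) V(1) W(2)])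
        show "\<exists>S \<in> nsets D (q + 1). nsets S 3 \<subseteq> H" if "D \<subseteq> {..N}" "card D = K * g" for D
          by (rule H(2)) (use that in \<open>simp_all only: N K_def mult.assoc\<close>)
      qed
      then show ?thesis unfolding q(2) by simp
    qed
    show "erdos_rogers 4 s (s + 1) n < 2 ^ (K * q ^ (G * D)) \<and> 1 \<le> erdos_rogers 4 s (s + 1) n"
      using erdos_rogers_bounds[OF gr V(2) free big _ n(1)] s unfolding g_def by simp
  qed
qed

text \<open>
Solving \<open>ln N = D q^(G D) ln q \<ge> 2 X\<close> for \<open>X = ln (ln n)\<close>: the solution has \<open>q^(G D)\<close> of order
\<open>X / ln X\<close>, since then \<open>D\<close> is of order \<open>ln X\<close>.
\<close>

lemma parameter_choice:
  fixes q G :: nat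
  assumes q: "2 \<le> q" and G: "0 < G"
  shows "\<forall>\<^sub>F n in sequentially. \<exists>D\<ge>32. n \<le> 2 ^ (q ^ (D * q ^ (G * D)) - 1) \<and>
    real (q ^ (G * D)) \<le> real q ^ G * (4 * G) * (ln (ln (real n)) / ln (ln (ln (real n))))"
proof -
  define c where "c = real q ^ (32 * G)"
  have "\<forall>\<^sub>F X :: real in at_top. c \<le> X / ln X"
  proof -
    have "filterlim (\<lambda>X :: real. X / ln X) at_top at_top" by real_asymp
    then show ?thesis unfolding filterlim_at_top by blast
  qed
  moreover have "\<forall>\<^sub>F X :: real in at_top. sqrt X \<le> X / ln X" by real_asymp
  moreover have "\<forall>\<^sub>F X :: real in at_top. 3 \<le> X" by (rule eventually_ge_at_top)
  ultimately have "\<forall>\<^sub>F X :: real in at_top. c \<le> X / ln X \<and> sqrt X \<le> X / ln X \<and> 3 \<le> X"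
    by (intro eventually_conj)
  moreover have "filterlim (\<lambda>n. ln (ln (real n))) at_top sequentially" by real_asymp
  ultimately have ev: "\<forall>\<^sub>F n in sequentially. c \<le> ln (ln (real n)) / ln (ln (ln (real n)))
      \<and> sqrt (ln (ln (real n))) \<le> ln (ln (real n)) / ln (ln (ln (real n))) \<and> 3 \<le> ln (ln (real n))"
    by (rule eventually_compose_filterlim)
  moreover have "\<forall>\<^sub>F n in sequentially. 3 \<le> ln (real n)" by real_asymp
  ultimately show ?thesis
  proof eventually_elim
    case (elim n)
    define y where "y = ln (real n)"
    define X where "X = ln y"
    \<comment> \<open>The factor \<open>4 G\<close> makes up for \<open>D \<ge> ln Z / (G ln q)\<close> and \<open>ln Z \<ge> ln X / 2\<close>, with a factor of \<open>2\<close> to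
      spare for passing from \<open>ln n\<close> to the logarithm of \<open>n\<close> to base \<open>2\<close>.\<close>
    define Z where "Z = 4 * G * (X / ln X)"
    have y: "3 \<le> y" and X: "c \<le> X / ln X" "sqrt X \<le> X / ln X" "3 \<le> X"
      using elim unfolding X_def y_def by auto
    have n0: "0 < n" using y unfolding y_def by (cases n) auto
    have lnX: "0 < ln X" using X(3) by simp
    have G1: "1 \<le> 4 * real G" using G by simp
    have "1 * (X / ln X) \<le> 4 * real G * (X / ln X)"
      using X(3) lnX by (intro mult_right_mono G1) auto
    then have ZX: "X / ln X \<le> Z" unfolding Z_def by simp
    have c1: "1 \<le> c" unfolding c_def using q by (simp add: one_le_power)
    have Z1: "1 \<le> Z" using ZX X(1) c1 by linarith
    have lq: "0 < ln q" using q by simp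
    have Gq: "0 < G * ln q" using G lq by simp
    define D where "D = nat \<lceil>ln Z / (G * ln q)\<rceil>"
    have D1: "ln Z / (G * ln q) \<le> D" "real D \<le> ln Z / (G * ln q) + 1"
      using Z1 Gq unfolding D_def by (simp_all add: of_nat_ceiling)
    have GD: "real (q ^ (G * D)) = exp (G * ln q * D)"
    proof -
      have "G * ln q * D = real (G * D) * ln q" by simp
      then show ?thesis using q by (simp only: exp_of_nat_mult) simp
    qed
    have lo: "Z \<le> real (q ^ (G * D))"
    proof -
      have "ln Z \<le> G * ln q * D" using D1(1) Gq by (simp add: pos_divide_le_eq mult.commute)
      then have "exp (ln Z) \<le> exp (G * ln q * D)" by simp
      then show ?thesis unfolding GD using Z1 by simp
    qed
    have hi: "real (q ^ (G * D)) \<le> real q ^ G * Z"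
    proof -
      have "G * ln q * D \<le> G * ln q * (ln Z / (G * ln q) + 1)"
        using D1(2) Gq by (intro mult_left_mono) auto
      also have "\<dots> = ln Z + ln (real q ^ G)" using Gq q G by (simp add: distrib_left ln_realpow)
      finally have "exp (G * ln q * D) \<le> exp (ln Z + ln (real q ^ G))" by simp
      then show ?thesis unfolding GD using Z1 q by (simp add: exp_add mult.commute)
    qed
    have "32 \<le> D"
    proof -
      have "c \<le> Z" using X(1) ZX by linarith
      then have "ln c \<le> ln Z" using c1 by simp
      moreover have "ln c = 32 * (G * ln q)" unfolding c_def using q by (simp add: ln_realpow)
      ultimately have "32 \<le> ln Z / (G * ln q)" using Gq by (simp add: pos_le_divide_eq)
      then show ?thesis using D1(1) by linarith
    qed
    moreover have "n \<le> 2 ^ (q ^ (D * q ^ (G * D)) - 1)"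
    proof -
      define N where "N = q ^ (D * q ^ (G * D))"
      have "ln (sqrt X) \<le> ln Z"
        using order.trans[OF X(2) ZX] X(3) Z1 by (subst ln_le_cancel_iff) auto
      then have lZ: "ln X / 2 \<le> ln Z" using X(3) by (simp add: ln_sqrt)
      have "2 * X = (ln X / 2 / G) * Z"
        unfolding Z_def using lnX G by simp
      also have "\<dots> \<le> (ln Z / G) * real (q ^ (G * D))"
        using lZ lo Z1 lnX by (intro mult_mono divide_right_mono) auto
      also have "\<dots> \<le> (D * ln q) * real (q ^ (G * D))"
      proof (rule mult_right_mono)
        have "ln Z / (G * ln q) * ln q \<le> D * ln q" using D1(1) lq by (intro mult_right_mono) auto
        then show "ln Z / G \<le> D * ln q" using lq by simp
      qed simp
      also have "\<dots> = ln N" unfolding N_def using q by (simp add: ln_realpow)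
      finally have "exp (2 * X) \<le> exp (ln N)" by simp
      moreover have "0 < N" unfolding N_def using q by simp
      moreover have "exp (2 * X) = y\<^sup>2"
        unfolding X_def using y by (simp add: exp_double)
      ultimately have Ny: "y\<^sup>2 \<le> N" by simp
      have "3 * y \<le> y * y" using y by (intro mult_right_mono) auto
      then have "2 * y + 1 \<le> N" using Ny y unfolding power2_eq_square by linarith
      then have "y \<le> (N - 1) * (1 / 2)" by simp
      also have "\<dots> \<le> (N - 1) * ln 2"
        using ln_le_minus_one[of "1 / 2 :: real"] \<open>0 < N\<close>
        by (intro mult_left_mono) (simp_all add: ln_div)
      also have "\<dots> = ln (2 ^ (N - 1))" using \<open>0 < N\<close> by (simp add: ln_realpow of_nat_diff)
      finally have "real n \<le> 2 ^ (N - 1)" unfolding y_def using n0 by (subst (asm) ln_le_cancel_iff) auto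
      then have "real n \<le> real (2 ^ (N - 1))" by simp
      then show ?thesis unfolding N_def by (simp only: of_nat_le_iff)
    qed
    moreover have "real (q ^ (G * D)) \<le> real q ^ G * (4 * G) * (ln (ln (real n)) / ln (ln (ln (real n))))"
      using hi unfolding Z_def X_def y_def by (simp add: mult.assoc)
    ultimately show ?case by blast
  qed
qed

theorem theorem1p5:
  fixes s :: nat
  assumes "s \<ge> 4"
  shows "(\<exists>C::real. C > 0 \<and>
            (\<forall>\<^sub>F n in sequentially.
               real (erdos_rogers 4 s (s + 1) n)
                 \<le> exp (C * (ln (ln (real n)) / ln (ln (ln (real n)))))))
       \<and> (\<exists>g :: nat \<Rightarrow> real. g \<in> o(\<lambda>_. 1) \<and>
            (\<forall>\<^sub>F n in sequentially.
               real (erdos_rogers 4 s (s + 1) n) = ln (real n) powr g n))"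
proof -
  obtain q G K :: nat where qGK: "2 \<le> q" "0 < G" "0 < K" and graph:
    "\<And>D n. 32 \<le> D \<Longrightarrow> 0 < n \<Longrightarrow> n \<le> 2 ^ (q ^ (D * q ^ (G * D)) - 1) \<Longrightarrow>
      erdos_rogers 4 s (s + 1) n < 2 ^ (K * q ^ (G * D)) \<and> 1 \<le> erdos_rogers 4 s (s + 1) n"
    by (rule four_graph_bound[OF assms]) (rule that; blast)
  let ?f = "\<lambda>n. real (erdos_rogers 4 s (s + 1) n)"
  let ?R = "\<lambda>n. ln (ln (real n)) / ln (ln (ln (real n)))"
  define C where "C = real K * (real q ^ G * (4 * G))"
  have C: "0 < C" unfolding C_def using qGK by simp
  have bounds: "\<forall>\<^sub>F n in sequentially. 1 \<le> ?f n \<and> ?f n \<le> exp (C * ?R n)"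
    using parameter_choice[OF qGK(1,2)] eventually_gt_at_top[of 0]
  proof eventually_elim
    case (elim n)
    then obtain D where D: "32 \<le> D" "n \<le> 2 ^ (q ^ (D * q ^ (G * D)) - 1)"
      "real (q ^ (G * D)) \<le> real q ^ G * (4 * G) * ?R n" by blast
    have er: "erdos_rogers 4 s (s + 1) n < 2 ^ (K * q ^ (G * D))" "1 \<le> erdos_rogers 4 s (s + 1) n"
      using graph[OF D(1) elim(2) D(2)] by auto
    have "?f n \<le> real (2 ^ (K * q ^ (G * D)))" using er(1) by (simp only: of_nat_le_iff)
    also have "\<dots> = exp (real (K * q ^ (G * D)) * ln 2)"
      by (simp only: exp_of_nat_mult) simp
    also have "\<dots> \<le> exp (real (K * q ^ (G * D)) * 1)"
      using ln_le_minus_one[of "2 :: real"] by (intro exp_le_cancel_iff[THEN iffD2] mult_left_mono) auto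
    also have "\<dots> \<le> exp (C * ?R n)"
      using mult_left_mono[OF D(3), of "real K"] unfolding C_def by (simp add: mult_ac)
    finally show ?case using er(2) by simp
  qed
  have "\<forall>\<^sub>F n in sequentially. ?f n \<le> exp (C * ?R n)"
    using bounds by eventually_elim simp
  then have first: "\<exists>C::real. C > 0 \<and> (\<forall>\<^sub>F n in sequentially. ?f n \<le> exp (C * ?R n))"
    using C by blast
  \<comment> \<open>As \<open>1 \<le> f\<close>, this exponent lies between \<open>0\<close> and \<open>C / ln (ln (ln n))\<close>.\<close>
  define g where "g n = ln (?f n) / ln (ln (real n))" for n
  have large: "\<forall>\<^sub>F n in sequentially. 1 < ln (real n) \<and> 0 < ln (ln (real n))"
    by (intro eventually_conj; real_asymp)
  have "\<forall>\<^sub>F n in sequentially. 0 \<le> g n \<and> g n \<le> C / ln (ln (ln (real n)))"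
    using bounds large
  proof eventually_elim
    case (elim n)
    have "ln (?f n) \<le> ln (exp (C * ?R n))"
      using elim(1) by (subst ln_le_cancel_iff) auto
    then have "ln (?f n) / ln (ln (real n)) \<le> C * ?R n / ln (ln (real n))"
      using elim(2) by (intro divide_right_mono) auto
    also have "\<dots> = C / ln (ln (ln (real n)))" using elim(2) by simp
    finally show ?case using elim unfolding g_def by simp
  qed
  moreover have "(\<lambda>n. C / ln (ln (ln (real n)))) \<longlonglongrightarrow> 0" by real_asymp
  ultimately have "g \<longlonglongrightarrow> 0"
    by (intro tendsto_sandwich[of "\<lambda>_. 0" g sequentially "\<lambda>n. C / ln (ln (ln (real n)))"])
      (auto elim: eventually_mono)
  then have "g \<in> o(\<lambda>_. 1)" by (intro smalloI_tendsto) auto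
  moreover have "\<forall>\<^sub>F n in sequentially. ?f n = ln (real n) powr g n"
    using bounds large
  proof eventually_elim
    case (elim n)
    then show ?case unfolding g_def powr_def by simp
  qed
  ultimately show ?thesis using first by blast
qed

end
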